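(* Let $G=SO(4)$. Define $E_{1,3}\in\Omega^3(SO(4))$ and $E_{2,2}\in\Omega^2(SO(4)\times SO(4))$ by $$E_{1,3}=\frac1{192\pi^2}\sum_{\tau\in\mathfrak S_4}\mathrm{sgn}(\tau)\Bigl((h^{-1}dh)_{\tau(1)\tau(2)}\wedge(h^{-1}dh)^2_{\tau(3)\tau(4)}+(h^{-1}dh)^2_{\tau(1)\tau(2)}\wedge(h^{-1}dh)_{\tau(3)\tau(4)}\Bigr),$$ $$E_{2,2}=\frac{-1}{64\pi^2}\sum_{\tau\in\mathfrak S_4}\mathrm{sgn}(\tau)\Bigl((h_1^{-1}dh_1)_{\tau(1)\tau(2)}\wedge(dh_2h_2^{-1})_{\tau(3)\tau(4)}-(dh_2h_2^{-1})_{\tau(1)\tau(2)}\wedge(h_1^{-1}dh_1)_{\tau(3)\tau(4)}\Bigr).$$ Then $E_{1,3}+E_{2,2}$ is a cocycle in the total complex $\Omega^4(NG)$ (that is, $d''E_{1,3}=0$, $d'E_{1,3}+d''E_{2,2}=0$ and $d'E_{2,2}=0$), and it represents the Euler class of $ESO(4)\to BSO(4)$.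
   Context: Simplicial manifolds. For a Lie group $G$, $NG(q)=G^q\ni(h_1,\dots,h_q)$ with face operators $\varepsilon_0(h_1,\dots,h_q)=(h_2,\dots,h_q)$, $\varepsilon_i(h_1,\dots,h_q)=(h_1,\dots,h_ih_{i+1},\dots,h_q)$ for $1\le i\le q-1$, $\varepsilon_q(h_1,\dots,h_q)=(h_1,\dots,h_{q-1})$. $N\bar G(q)=G^{q+1}\ni(g_0,\dots,g_q)$, with $\varepsilon_i$ deleting $g_i$, and $\gamma:N\bar G\to NG$, $\gamma(g_0,\dots,g_q)=(g_0g_1^{-1},\dots,g_{q-1}g_q^{-1})$, is a simplicial principal $G$-bundle whose fat realization is the universal bundle $EG\to BG$. Double complex. $\Omega^{r,s}(NG)=\Omega^s(NG(r))$ with $d'=\sum_{i=0}^{r+1}(-1)^i\varepsilon_i^*$ and $d''=(-1)^r\times$ exterior differential; $\Omega^*(NG)$ denotes the total complex with differential $d'+d''$, and $H(\Omega^*(NG))\cong H^*(BG)$ (real coefficients). Euler class. Let $G=SO(2p)$ (here $p=2$). On $\Delta^r\times N\bar G(r)$, with barycentric coordinates $(t_0,\dots,t_r)$ on the simplex $\Delta^r$, put $\theta=t_0\theta_0+\cdots+t_r\theta_r$, where $\theta_i=g_i^{-1}dg_i$, and $\Omega=d\theta+\frac12[\theta,\theta]=d\theta+\theta\wedge\theta$. Let $$\mathrm{Pf}(A,\dots,A)=\frac1{2^{2p}\pi^pp!}\sum_{\tau\in\mathfrak S_{2p}}\mathrm{sgn}(\tau)\,a_{\tau(1)\tau(2)}\cdots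 a_{\tau(2p-1)\tau(2p)},\qquad A=(a_{ij})\in\mathfrak{so}(2p).$$ The forms $\mathrm{Pf}(\Omega)$ are basic and descend to $\Delta^r\times NG(r)$; $I_\Delta(\mathrm{Pf}(\Omega))\in\Omega^{2p}(NG)$ denotes the cocycle whose component on $NG(r)$ is $\int_{\Delta^r}\mathrm{Pf}(\Omega)$ (fibre integration: $\int_{\Delta^r}f\,dt_1\wedge\cdots\wedge dt_r\wedge\omega=(\int_{\Delta^r} f\,dt_1\cdots dt_r)\,\omega$, and terms of lower degree in the $dt_i$ integrate to $0$). A cocycle in $\Omega^{2p}(NG)$ represents the Euler class of $ESO(2p)\to BSO(2p)$ if its class equals $[I_\Delta(\mathrm{Pf}(\Omega))]$, the image of $\mathrm{Pf}$ under the Chern–Weil homomorphism. Notation. $h$ is the matrix coordinate on $NG(1)=G$ and $(h_1,h_2)$ those on $NG(2)=G\times G$; $M_{ab}$ is the $(a,b)$ entry of a matrix $M$ of forms, and $(h^{-1}dh)^2_{ab}$ is the $(a,b)$ entry of the matrix product $(h^{-1}dh)(h^{-1}dh)$, entries being multiplied by wedge product. *)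

theory Defs
  imports "HOL-Analysis.Analysis"
begin

section \<open>Differential forms on submanifolds of a normed space\<close>

text \<open>
  A \<open>k\<close>-form is evaluated at a point and a sequence of vectors, of which only the entries
  \<open>0, \<dots>, k - 1\<close> matter. The degree is passed explicitly wherever it is needed.

  A form on an embedded submanifold \<open>M\<close> of a normed space is represented by a form that is
  defined and smooth on some open neighbourhood of \<open>M\<close>. Two representatives are the same form
  on \<open>M\<close> iff they agree on tangent vectors of \<open>M\<close> (\<open>form_eq\<close>). Exterior derivative and
  pullback are computed on representatives; since the exterior derivative commutes with the
  restriction to \<open>M\<close>, this is the intrinsic one. The same convention is used for
  manifolds with corners, such as simplices.
\<close>

type_synonym ('a, 'b) form = "'a \<Rightarrow> (nat \<Rightarrow> 'a) \<Rightarrow> 'b"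

text \<open>
  Iterated directional derivatives are taken along constant vectors; this keeps the type
  fixed in the recursion. On a finite-dimensional space it is the usual notion of a
  \<open>C\<^sup>k\<close> function. If \<open>M\<close> lies in a finite-dimensional subspace of the ambient space, as below,
  only the behaviour on that subspace enters, so restrictions of forms that are smooth in
  this sense are exactly the smooth forms on \<open>M\<close>.
\<close>

primrec Ck_on :: "nat \<Rightarrow> ('a::real_normed_vector \<Rightarrow> 'b::real_normed_vector) \<Rightarrow> 'a set \<Rightarrow> bool" where
  "Ck_on 0 f U = continuous_on U f"
| "Ck_on (Suc k) f U \<longleftrightarrow> (\<forall>x\<in>U. f differentiable (at x)) \<and>
     (\<forall>v. Ck_on k (\<lambda>x. frechet_derivative f (at x) v) U)"

definition alternating_form :: "nat \<Rightarrow> ((nat \<Rightarrow> 'a::real_normed_vector) \<Rightarrow> real) \<Rightarrow> bool" where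
  "alternating_form k \<phi> \<longleftrightarrow>
     (\<forall>v w. (\<forall>i<k. v i = w i) \<longrightarrow> \<phi> v = \<phi> w) \<and>
     (\<forall>v. \<forall>i<k. bounded_linear (\<lambda>u. \<phi> (v(i := u)))) \<and>
     (\<forall>v. \<forall>i<k. \<forall>j<k. i \<noteq> j \<and> v i = v j \<longrightarrow> \<phi> v = 0)"

definition smooth_form :: "nat \<Rightarrow> 'a::real_normed_vector set \<Rightarrow> ('a, real) form \<Rightarrow> bool" where
  "smooth_form k M \<omega> \<longleftrightarrow>
     (\<exists>U. open U \<and> M \<subseteq> U \<and> (\<forall>x\<in>U. alternating_form k (\<omega> x)) \<and>
          (\<forall>v. \<forall>n. Ck_on n (\<lambda>x. \<omega> x v) U))"

text \<open>
  One-sided curves are used so that at a corner of \<open>M\<close> the span of the velocities is the full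
  tangent space.
\<close>

definition tangent_space :: "'a::real_normed_vector set \<Rightarrow> 'a \<Rightarrow> 'a set" where
  "tangent_space M x = span {u. \<exists>c :: real \<Rightarrow> 'a. c 0 = x \<and> c ` {0..1} \<subseteq> M \<and>
      (c has_vector_derivative u) (at 0 within {0..1})}"

definition form_eq :: "'a::real_normed_vector set \<Rightarrow> ('a, 'b) form \<Rightarrow> ('a, 'b) form \<Rightarrow> bool" where
  "form_eq M \<omega> \<eta> \<longleftrightarrow> (\<forall>x\<in>M. \<forall>v. (\<forall>i. v i \<in> tangent_space M x) \<longrightarrow> \<omega> x v = \<eta> x v)"

definition pullback ::
    "('a::real_normed_vector \<Rightarrow> 'c::real_normed_vector) \<Rightarrow> ('c, 'b) form \<Rightarrow> ('a, 'b) form" where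
  "pullback f \<omega> = (\<lambda>x v. \<omega> (f x) (\<lambda>i. frechet_derivative f (at x) (v i)))"

text \<open>The exterior derivative of a \<open>k\<close>-form:
  \<open>d\<omega>(v\<^sub>0, \<dots>, v\<^sub>k) = \<Sum>\<^sub>i (-1)\<^sup>i D\<^sub>v\<^sub>i (\<omega>(v\<^sub>0, \<dots>, v\<^sub>i\<^sub>-\<^sub>1, v\<^sub>i\<^sub>+\<^sub>1, \<dots>, v\<^sub>k))\<close>.\<close>

definition ext_deriv ::
    "nat \<Rightarrow> ('a::real_normed_vector, 'b::real_normed_vector) form \<Rightarrow> ('a, 'b) form" where
  "ext_deriv k \<omega> = (\<lambda>x v. \<Sum>i\<le>k. (-1) ^ i *\<^sub>R
     frechet_derivative (\<lambda>y. \<omega> y (\<lambda>j. if j < i then v j else v (Suc j))) (at x) (v i))"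

text \<open>The normalisation is the one with \<open>(dx \<and> dy)(u, v) = dx(u) dy(v) - dx(v) dy(u)\<close>.\<close>

definition wedge :: "nat \<Rightarrow> nat \<Rightarrow> ('a, real) form \<Rightarrow> ('a, real) form \<Rightarrow> ('a, real) form" where
  "wedge k l \<alpha> \<beta> = (\<lambda>x v. (\<Sum>\<sigma> | \<sigma> permutes {..<k + l}.
      of_int (sign \<sigma>) * \<alpha> x (\<lambda>i. v (\<sigma> i)) * \<beta> x (\<lambda>i. v (\<sigma> (k + i)))) / (fact k * fact l))"

type_synonym mat4 = "real^4^4"

definition entry :: "('a, mat4) form \<Rightarrow> 4 \<Rightarrow> 4 \<Rightarrow> ('a, real) form" where
  "entry A a b = (\<lambda>x v. A x v $ a $ b)"

definition mat_wedge :: "nat \<Rightarrow> nat \<Rightarrow> ('a, mat4) form \<Rightarrow> ('a, mat4) form \<Rightarrow> ('a, mat4) form" where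
  "mat_wedge k l A B = (\<lambda>x v. \<chi> a b. \<Sum>c\<in>UNIV. wedge k l (entry A a c) (entry B c b) x v)"

section \<open>The simplicial manifolds\<close>

text \<open>
  Tuples of varying length live in one normed space, the bounded sequences with the supremum
  norm; the entries outside the index range are zero. Thus the points of \<open>NG q\<close> have entries
  \<open>h\<^sub>1, \<dots>, h\<^sub>q\<close>, those of \<open>NbarG q\<close> have entries \<open>g\<^sub>0, \<dots>, g\<^sub>q\<close>, and those of \<open>Simplex q\<close>
  have entries \<open>t\<^sub>0, \<dots>, t\<^sub>q\<close>.
\<close>

type_synonym 'b bseq = "nat \<Rightarrow>\<^sub>C 'b"

definition fin_seq :: "nat set \<Rightarrow> (nat \<Rightarrow> 'b) \<Rightarrow> 'b::real_normed_vector bseq" where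
  "fin_seq I f = Bcontfun (\<lambda>i. if i \<in> I then f i else 0)"

lemma apply_fin_seq:
  assumes "finite I"
  shows "apply_bcontfun (fin_seq I f) i = (if i \<in> I then f i else 0)"
proof -
  have "range (\<lambda>i. if i \<in> I then f i else 0) \<subseteq> insert 0 (f ` I)" by auto
  then have "finite (range (\<lambda>i. if i \<in> I then f i else 0))"
    using assms by (meson finite_imageI finite_insert finite_subset)
  then have "(\<lambda>i. if i \<in> I then f i else 0) \<in> bcontfun"
    by (simp add: bcontfun_def finite_imp_bounded)
  then show ?thesis by (simp add: fin_seq_def Bcontfun_inverse)
qed

definition SO4 :: "mat4 set" where
  "SO4 = {A. orthogonal_matrix A \<and> det A = 1}"

definition NG :: "nat \<Rightarrow> mat4 bseq set" where
  "NG q = {h :: mat4 bseq. (\<forall>i\<in>{1..q}. h i \<in> SO4) \<and> (\<forall>i. i \<notin> {1..q} \<longrightarrow> h i = 0)}"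

text \<open>\<open>face q i\<close> is \<open>\<epsilon>\<^sub>i : NG(q) \<rightarrow> NG(q - 1)\<close>; the cases \<open>i = 0\<close> and \<open>i = q\<close> come out as
  \<open>(h\<^sub>2, \<dots>, h\<^sub>q)\<close> and \<open>(h\<^sub>1, \<dots>, h\<^sub>q\<^sub>-\<^sub>1)\<close> because then \<open>j = i\<close> is outside the index range.\<close>

definition face :: "nat \<Rightarrow> nat \<Rightarrow> mat4 bseq \<Rightarrow> mat4 bseq" where
  "face q i h = fin_seq {1..q - 1}
     (\<lambda>j. if j < i then h j else if j = i then h j ** h (Suc j) else h (Suc j))"

definition NbarG :: "nat \<Rightarrow> mat4 bseq set" where
  "NbarG q = {g :: mat4 bseq. (\<forall>i\<in>{0..q}. g i \<in> SO4) \<and> (\<forall>i. i \<notin> {0..q} \<longrightarrow> g i = 0)}"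

definition gamma :: "nat \<Rightarrow> mat4 bseq \<Rightarrow> mat4 bseq" where
  "gamma q g = fin_seq {1..q} (\<lambda>i. g (i - 1) ** matrix_inv (g i))"

definition Simplex :: "nat \<Rightarrow> real bseq set" where
  "Simplex q = {t :: real bseq. (\<forall>i\<in>{0..q}. 0 \<le> t i) \<and> (\<forall>i. i \<notin> {0..q} \<longrightarrow> t i = 0) \<and> (\<Sum>i=0..q. t i) = 1}"

section \<open>The total complex of the double complex\<close>

text \<open>\<open>d_hor r\<close> is \<open>d' : \<Omega>\<^sup>s(NG(r)) \<rightarrow> \<Omega>\<^sup>s(NG(r + 1))\<close> and \<open>d_ver r s\<close> is
  \<open>d'' : \<Omega>\<^sup>s(NG(r)) \<rightarrow> \<Omega>\<^sup>s\<^sup>+\<^sup>1(NG(r))\<close>.\<close>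

definition d_hor :: "nat \<Rightarrow> (mat4 bseq, real) form \<Rightarrow> (mat4 bseq, real) form" where
  "d_hor r \<omega> = (\<lambda>x v. \<Sum>i=0..r + 1. (-1) ^ i * pullback (face (r + 1) i) \<omega> x v)"

definition d_ver :: "nat \<Rightarrow> nat \<Rightarrow> (mat4 bseq, real) form \<Rightarrow> (mat4 bseq, real) form" where
  "d_ver r s \<omega> = (\<lambda>x v. (-1) ^ r * ext_deriv s \<omega> x v)"

text \<open>A cochain of total degree \<open>n\<close> is a family \<open>c\<close> with \<open>c r \<in> \<Omega>\<^sup>n\<^sup>-\<^sup>r(NG(r))\<close> for
  \<open>r \<le> n\<close>; the entries \<open>c r\<close> with \<open>r > n\<close> are irrelevant.\<close>

type_synonym cochain = "nat \<Rightarrow> (mat4 bseq, real) form"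

definition is_cochain :: "nat \<Rightarrow> cochain \<Rightarrow> bool" where
  "is_cochain n c \<longleftrightarrow> (\<forall>r\<le>n. smooth_form (n - r) (NG r) (c r))"

definition d_tot :: "nat \<Rightarrow> cochain \<Rightarrow> cochain" where
  "d_tot n c = (\<lambda>r x v.
     (if r = 0 then 0 else d_hor (r - 1) (c (r - 1)) x v) +
     (if r \<le> n then d_ver r (n - r) (c r) x v else 0))"

definition cochain_eq :: "nat \<Rightarrow> cochain \<Rightarrow> cochain \<Rightarrow> bool" where
  "cochain_eq n c c' \<longleftrightarrow> (\<forall>r\<le>n. form_eq (NG r) (c r) (c' r))"

definition is_cocycle :: "nat \<Rightarrow> cochain \<Rightarrow> bool" where
  "is_cocycle n c \<longleftrightarrow> is_cochain n c \<and> cochain_eq (n + 1) (d_tot n c) (\<lambda>r x v. 0)"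

definition is_coboundary :: "nat \<Rightarrow> cochain \<Rightarrow> bool" where
  "is_coboundary n c \<longleftrightarrow>
     (if n = 0 then cochain_eq 0 c (\<lambda>r x v. 0)
      else \<exists>b. is_cochain (n - 1) b \<and> cochain_eq n c (d_tot (n - 1) b))"

definition cohomologous :: "nat \<Rightarrow> cochain \<Rightarrow> cochain \<Rightarrow> bool" where
  "cohomologous n c c' \<longleftrightarrow> is_coboundary n (\<lambda>r x v. c r x v - c' r x v)"

section \<open>The Euler class\<close>

text \<open>The forms \<open>\<theta>\<close> and \<open>\<Omega>\<close> on \<open>\<Delta>\<^sup>r \<times> NbarG r\<close>, at the point \<open>x = (t, g)\<close>.\<close>

definition theta :: "nat \<Rightarrow> (real bseq \<times> mat4 bseq, mat4) form" where
  "theta r = (\<lambda>x w. \<Sum>i=0..r. apply_bcontfun (fst x) i *\<^sub>R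
     (matrix_inv (apply_bcontfun (snd x) i) ** apply_bcontfun (snd (w 0)) i))"

definition curvature :: "nat \<Rightarrow> (real bseq \<times> mat4 bseq, mat4) form" where
  "curvature r = (\<lambda>x w. ext_deriv 1 (theta r) x w + mat_wedge 1 1 (theta r) (theta r) x w)"

text \<open>The Pfaffian \<open>Pf(A, A)\<close> for \<open>p = 2\<close>, with \<open>A\<close> a matrix of 2-forms. As a type, \<open>4\<close> has
  the elements \<open>1, 2, 3\<close> and \<open>4 = 0\<close>.\<close>

definition Pf :: "('a, mat4) form \<Rightarrow> ('a, real) form" where
  "Pf A = (\<lambda>x v. 1 / (2 ^ 4 * pi ^ 2 * fact 2) *
     (\<Sum>\<tau> | \<tau> permutes (UNIV :: 4 set).
        of_int (sign \<tau>) * wedge 2 2 (entry A (\<tau> 1) (\<tau> 2)) (entry A (\<tau> 3) (\<tau> 4)) x v))"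

text \<open>\<open>P\<close> is the form on \<open>\<Delta>\<^sup>r \<times> NG(r)\<close> to which \<open>Pf(\<Omega>)\<close> descends along \<open>id \<times> \<gamma>\<close>. It is unique up
  to \<open>form_eq\<close>, since \<open>\<gamma>\<close> is a surjective submersion.\<close>

definition descended_Pf :: "nat \<Rightarrow> (real bseq \<times> mat4 bseq, real) form \<Rightarrow> bool" where
  "descended_Pf r P \<longleftrightarrow> smooth_form 4 (Simplex r \<times> NG r) P \<and>
     form_eq (Simplex r \<times> NbarG r)
       (pullback (\<lambda>(t, g). (t, gamma r g)) P) (Pf (curvature r))"

text \<open>
  Fibre integration over \<open>\<Delta>\<^sup>r\<close>, with \<open>t\<^sub>1, \<dots>, t\<^sub>r\<close> as coordinates and \<open>t\<^sub>0 = 1 - t\<^sub>1 - \<dots> - t\<^sub>r\<close>.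
  Contracting with the coordinate fields \<open>\<partial>/\<partial>t\<^sub>1, \<dots>, \<partial>/\<partial>t\<^sub>r\<close> (in this order, in front) turns
  \<open>f dt\<^sub>1 \<and> \<dots> \<and> dt\<^sub>r \<and> \<omega>\<close> into \<open>f \<omega>\<close> and kills terms of lower degree in the \<open>dt\<^sub>i\<close>.
\<close>

definition bary :: "nat \<Rightarrow> (nat \<Rightarrow> real) \<Rightarrow> real bseq" where
  "bary r s = fin_seq {0..r} (\<lambda>i. if i = 0 then 1 - (\<Sum>j=1..r. s j) else s i)"

definition coord_field :: "nat \<Rightarrow> real bseq" where
  "coord_field i = fin_seq {0, i} (\<lambda>j. if j = 0 then -1 else 1)"

definition fibre_integral ::
    "nat \<Rightarrow> (real bseq \<times> mat4 bseq, real) form \<Rightarrow> (mat4 bseq, real) form" where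
  "fibre_integral r P = (\<lambda>x v.
     set_lebesgue_integral (\<Pi>\<^sub>M i\<in>{1..r}. lborel)
       {s \<in> {1..r} \<rightarrow>\<^sub>E UNIV. (\<forall>i\<in>{1..r}. 0 \<le> s i) \<and> (\<Sum>i=1..r. s i) \<le> 1}
       (\<lambda>s. P (bary r s, x) (\<lambda>j. if j < r then (coord_field (Suc j), 0) else (0, v (j - r)))))"

text \<open>The cochain \<open>\<lambda>r. fibre_integral r (P r)\<close> is \<open>I\<^sub>\<Delta>(Pf(\<Omega>))\<close>.\<close>

definition represents_Euler_class :: "cochain \<Rightarrow> bool" where
  "represents_Euler_class c \<longleftrightarrow> is_cocycle 4 c \<and>
     (\<exists>P. (\<forall>r. descended_Pf r (P r)) \<and> cohomologous 4 c (\<lambda>r. fibre_integral r (P r)))"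

section \<open>The explicit cochain\<close>

text \<open>\<open>left_MC i\<close> is \<open>h\<^sub>i\<^sup>-\<^sup>1 dh\<^sub>i\<close> and \<open>right_MC i\<close> is \<open>dh\<^sub>i h\<^sub>i\<^sup>-\<^sup>1\<close>.\<close>

definition left_MC :: "nat \<Rightarrow> (mat4 bseq, mat4) form" where
  "left_MC i = (\<lambda>h v. matrix_inv (h i) ** v 0 i)"

definition right_MC :: "nat \<Rightarrow> (mat4 bseq, mat4) form" where
  "right_MC i = (\<lambda>h v. v 0 i ** matrix_inv (h i))"

definition E13 :: "(mat4 bseq, real) form" where
  "E13 = (let A = left_MC 1; B = mat_wedge 1 1 A A in
     (\<lambda>x v. 1 / (192 * pi ^ 2) *
       (\<Sum>\<tau> | \<tau> permutes (UNIV :: 4 set). of_int (sign \<tau>) *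
          (wedge 1 2 (entry A (\<tau> 1) (\<tau> 2)) (entry B (\<tau> 3) (\<tau> 4)) x v +
           wedge 2 1 (entry B (\<tau> 1) (\<tau> 2)) (entry A (\<tau> 3) (\<tau> 4)) x v))))"

definition E22 :: "(mat4 bseq, real) form" where
  "E22 = (let A = left_MC 1; B = right_MC 2 in
     (\<lambda>x v. -1 / (64 * pi ^ 2) *
       (\<Sum>\<tau> | \<tau> permutes (UNIV :: 4 set). of_int (sign \<tau>) *
          (wedge 1 1 (entry A (\<tau> 1) (\<tau> 2)) (entry B (\<tau> 3) (\<tau> 4)) x v -
           wedge 1 1 (entry B (\<tau> 1) (\<tau> 2)) (entry A (\<tau> 3) (\<tau> 4)) x v))))"

definition E_cochain :: cochain where
  "E_cochain = (\<lambda>r. if r = 1 then E13 else if r = 2 then E22 else (\<lambda>x v. 0))"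

end

theory Submission
  imports Defs
begin

text \<open>
  The cochain is equal, and not only cohomologous, to \<open>I\<^sub>\<Delta>(Pf(\<Omega>))\<close>. In the gauge \<open>g\<^sub>0\<close>, that is along the
  section \<open>h \<mapsto> (1, h\<^sub>1\<^sup>-\<^sup>1, (h\<^sub>1h\<^sub>2)\<^sup>-\<^sup>1, \<dots>)\<close> of \<open>\<gamma>\<close>, the connection is a combination of the forms \<open>t\<^sub>i X\<^sub>i\<close> with
  \<open>X\<^sub>i\<close> pulled back from \<open>NG r\<close>, so \<open>Pf(\<Omega>)\<close> descends to a form that is polynomial in \<open>t\<close>. Each factor
  \<open>\<Omega>\<close> contains at most one \<open>dt\<^sub>i\<close>, hence the fibre integral vanishes unless \<open>r\<close> is \<open>1\<close> or \<open>2\<close>. For \<open>r = 1\<close> the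
  integral of \<open>t - t\<^sup>2\<close> over the interval gives the factor \<open>1/6\<close>, for \<open>r = 2\<close> the area of the triangle gives \<open>1/2\<close>.

  The cocycle conditions are identities for the bilinear form
  \<open>Q(A, B) = \<Sum>\<^sub>\<tau> sgn(\<tau>) A\<^sub>\<tau>\<^sub>1\<^sub>\<tau>\<^sub>2 B\<^sub>\<tau>\<^sub>3\<^sub>\<tau>\<^sub>4\<close>, where \<open>Q(g A g\<^sup>T, g B g\<^sup>T) = det(g) Q(A, B)\<close>. On skew-symmetric matrices
  the restriction of \<open>E\<^sub>1\<^sub>3\<close> is a multiple of the invariant trilinear form \<open>Q(X, [Y, Z])\<close>, and \<open>d E\<^sub>1\<^sub>3 = 0\<close> is the Jacobi identity.
\<close>

section \<open>Iterated differentiability\<close>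

lemma frechet_derivative_eq:
  "(f has_derivative f') (at x) \<Longrightarrow> frechet_derivative f (at x) = f'"
  by (metis frechet_derivative_at)

text \<open>Derivatives are local, so on an open set agreement of two functions passes to all
  iterated derivatives.\<close>

lemma Ck_on_cong:
  assumes "open U" "\<And>x. x \<in> U \<Longrightarrow> f x = g x" "Ck_on n f U"
  shows "Ck_on n g U"
  using assms(2,3)
proof (induction n arbitrary: f g)
  case 0
  then show ?case by (simp add: continuous_on_eq)
next
  case (Suc n)
  have D: "f differentiable at x" "g differentiable at x"
    "frechet_derivative g (at x) = frechet_derivative f (at x)" if "x \<in> U" for x
  proof -
    show 1: "f differentiable at x" using Suc.prems that by simp
    then show 2: "frechet_derivative g (at x) = frechet_derivative f (at x)"
      using frechet_derivative_transform_within_open[OF 1 assms(1) that] Suc.prems(1) by simp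
    from 1 obtain f' where "(f has_derivative f') (at x)" by (auto simp: differentiable_def)
    then have "(g has_derivative f') (at x)"
      using has_derivative_transform_within_open[OF _ assms(1) that] Suc.prems(1) by blast
    then show "g differentiable at x" by (auto simp: differentiable_def)
  qed
  have "Ck_on n (\<lambda>x. frechet_derivative g (at x) v) U" for v
    using Suc.IH[of "\<lambda>x. frechet_derivative f (at x) v" "\<lambda>x. frechet_derivative g (at x) v"] D Suc.prems
    by simp
  then show ?case using D by simp
qed

text \<open>Lets an explicit derivative formula replace the \<open>frechet_derivative\<close> in
  \<open>Ck_on\<close>. The two agree only on \<open>U\<close>, hence the detour through
  \<open>Ck_on_cong\<close>.\<close>

lemma Ck_on_SucI:
  assumes "open U" "\<And>x. x \<in> U \<Longrightarrow> (f has_derivative f' x) (at x)"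
    and "\<And>v. Ck_on n (\<lambda>x. f' x v) U"
  shows "Ck_on (Suc n) f U"
proof -
  have "Ck_on n (\<lambda>x. frechet_derivative f (at x) v) U" for v
    by (rule Ck_on_cong[OF assms(1) _ assms(3)[of v]])
      (simp add: frechet_derivative_eq[OF assms(2)])
  then show ?thesis using assms(2) by (auto simp: differentiable_def)
qed

lemma Ck_on_SucD:
  assumes "Ck_on (Suc n) f U"
  shows "\<And>x. x \<in> U \<Longrightarrow> (f has_derivative frechet_derivative f (at x)) (at x)"
    and "\<And>v. Ck_on n (\<lambda>x. frechet_derivative f (at x) v) U"
  using assms by (auto simp: frechet_derivative_works[symmetric])

text \<open>A product rule leaves one factor undifferentiated, so every induction on
  \<open>n\<close> through such a rule needs this step down.\<close>

lemma Ck_on_lower: "Ck_on (Suc n) f U \<Longrightarrow> Ck_on n f U"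
proof (induction n arbitrary: f)
  case 0
  then show ?case
    using has_derivative_continuous[OF Ck_on_SucD(1)[OF 0]] by (simp add: continuous_at_imp_continuous_on)
next
  case (Suc n)
  then show ?case by (metis Ck_on.simps(2))
qed

lemma Ck_on_const: "Ck_on n (\<lambda>x. c) U"
  by (induction n arbitrary: c) (auto simp: frechet_derivative_const)

lemma Ck_on_add:
  assumes "open U" "Ck_on n f U" "Ck_on n g U"
  shows "Ck_on n (\<lambda>x. f x + g x) U"
  using assms(2,3)
proof (induction n arbitrary: f g)
  case 0
  then show ?case by (simp add: continuous_on_add)
next
  case (Suc n)
  show ?case
    by (rule Ck_on_SucI[OF assms(1)])
      (rule has_derivative_add Ck_on_SucD[OF Suc.prems(1)] Ck_on_SucD[OF Suc.prems(2)] Suc.IH | assumption)+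
qed

lemma Ck_on_linear:
  assumes "open U" "bounded_linear L" "Ck_on n f U"
  shows "Ck_on n (\<lambda>x. L (f x)) U"
  using assms(3)
proof (induction n arbitrary: f)
  case 0
  then show ?case using bounded_linear.continuous_on[OF assms(2)] by simp
next
  case (Suc n)
  show ?case
    by (rule Ck_on_SucI[OF assms(1)])
      (rule bounded_linear.has_derivative[OF assms(2)] Ck_on_SucD[OF Suc.prems(1)] Suc.IH | assumption)+
qed

lemma Ck_on_ident: "open U \<Longrightarrow> Ck_on n (\<lambda>x. x) U"
  by (cases n) (auto intro!: Ck_on_SucI[where f'="\<lambda>_ v. v"] Ck_on_const simp del: Ck_on.simps(2))

lemma Ck_on_sum:
  assumes "open U" "\<And>i. i \<in> I \<Longrightarrow> Ck_on n (f i) U"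
  shows "Ck_on n (\<lambda>x. \<Sum>i\<in>I. f i x) U"
  using assms(2)
  by (induction I rule: infinite_finite_induct) (auto intro: Ck_on_const Ck_on_add[OF assms(1)])

lemma Ck_on_bilinear:
  assumes "open U" "bounded_bilinear h" "Ck_on n f U" "Ck_on n g U"
  shows "Ck_on n (\<lambda>x. h (f x) (g x)) U"
  using assms(3,4)
proof (induction n arbitrary: f g)
  case 0
  then show ?case using bounded_bilinear.continuous_on[OF assms(2)] by simp
next
  case (Suc n)
  show ?case
    by (rule Ck_on_SucI[OF assms(1)])
      (rule bounded_bilinear.FDERIV[OF assms(2)] Ck_on_SucD[OF Suc.prems(1)] Ck_on_SucD[OF Suc.prems(2)]
         Ck_on_add[OF assms(1)] Suc.IH Ck_on_lower[OF Suc.prems(1)] Ck_on_lower[OF Suc.prems(2)]| assumption)+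
qed

section \<open>Smoothness of matrix products and inverses\<close>

lemma bilinear_matrix_mult: "bilinear ((**) :: real^'n^'m \<Rightarrow> real^'k^'n \<Rightarrow> real^'k^'m)"
  unfolding bilinear_def
  by (auto intro!: linearI simp: vec_eq_iff matrix_matrix_mult_def sum.distrib sum_distrib_left algebra_simps)

lemma bounded_bilinear_matrix_mult:
  "bounded_bilinear ((**) :: real^'n^'m \<Rightarrow> real^'k^'n \<Rightarrow> real^'k^'m)"
  using bilinear_matrix_mult bilinear_conv_bounded_bilinear by blast

lemma bounded_linear_transpose: "bounded_linear (transpose :: real^'n^'m \<Rightarrow> real^'m^'n)"
  by (rule linear_conv_bounded_linear[THEN iffD1])
    (auto intro!: linearI simp: transpose_def vec_eq_iff)

lemma matrix_inv_mult:
  fixes A :: "real^'n^'n"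
  assumes "det A \<noteq> 0"
  shows "A ** matrix_inv A = mat 1" "matrix_inv A ** A = mat 1"
proof -
  have "\<exists>B. A ** B = mat 1 \<and> B ** A = mat 1"
    using assms by (simp add: invertible_det_nz[symmetric] invertible_def)
  then have "A ** matrix_inv A = mat 1 \<and> matrix_inv A ** A = mat 1"
    unfolding matrix_inv_def by (rule someI_ex)
  then show "A ** matrix_inv A = mat 1" "matrix_inv A ** A = mat 1" by auto
qed

text \<open>Cramer's rule makes each entry of the inverse a quotient of polynomials in the entries
  of \<open>A\<close>, from which its differentiability follows.\<close>

lemma matrix_inv_entry:
  fixes A :: "real^'n^'n"
  assumes "det A \<noteq> 0"
  shows "matrix_inv A $ k $ l =
    det (\<chi> i j. if j = k then axis l 1 $ i else A $ i $ j) / det A"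
proof -
  have "A *v (matrix_inv A *v axis l 1) = axis l 1"
    by (simp add: matrix_vector_mul_assoc matrix_inv_mult assms)
  then have "matrix_inv A *v axis l 1 =
      (\<chi> k. det (\<chi> i j. if j = k then axis l 1 $ i else A $ i $ j) / det A)"
    using cramer[OF assms] by blast
  then show ?thesis
    by (simp add: vec_eq_iff matrix_vector_mult_basis column_def)
qed

lemma differentiable_det:
  fixes f :: "'a::real_normed_vector \<Rightarrow> real^'n^'n"
  assumes "\<And>i j. (\<lambda>x. f x $ i $ j) differentiable at x"
  shows "(\<lambda>x. det (f x)) differentiable at x"
proof -
  have "(\<lambda>x. \<Prod>i\<in>I. f x $ i $ p i) differentiable at x" for I and p :: "'n \<Rightarrow> 'n"
    using assms by (induction I rule: infinite_finite_induct) auto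
  then show ?thesis unfolding det_def by (intro differentiable_sum) auto
qed

text \<open>Cramer's rule gives the existence of some derivative; its value is then forced by
  differentiating \<open>x ** matrix_inv x = mat 1\<close>, which holds on the open set of matrices
  with nonzero determinant.\<close>

lemma has_derivative_matrix_inv_ident:
  fixes A :: "real^'n^'n"
  assumes "det A \<noteq> 0"
  shows "(matrix_inv has_derivative (\<lambda>w. - (matrix_inv A ** w ** matrix_inv A))) (at A)"
proof -
  let ?U = "{A :: real^'n^'n. det A \<noteq> 0}"
  have entry: "(\<lambda>x::real^'n^'n. x $ i $ j) differentiable at x" for i j x
    by (intro bounded_linear_imp_differentiable bounded_linear_compose[OF bounded_linear_vec_nth bounded_linear_vec_nth])
  have "continuous_on UNIV (det :: real^'n^'n \<Rightarrow> real)"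
    by (intro continuous_at_imp_continuous_on ballI differentiable_imp_continuous_within differentiable_det entry)
  then have U: "open ?U"
    using continuous_on_open_vimage[of UNIV "det :: real^'n^'n \<Rightarrow> real"] open_UNIV
    by (force dest!: spec[of _ "- {0}"] simp: vimage_def)
  have cof: "(\<lambda>x::real^'n^'n. det (\<chi> i j. if j = k then axis l 1 $ i else x $ i $ j)) differentiable at A"
    for k l
    by (rule differentiable_det, case_tac "j = k") (simp_all add: entry)
  have "(\<lambda>x::real^'n^'n. det (\<chi> i j. if j = k then axis l 1 $ i else x $ i $ j) / det x) differentiable at A"
    for k l
    using assms by (intro differentiable_divide cof differentiable_det entry) auto
  then have "(\<lambda>x::real^'n^'n. matrix_inv x $ k $ l) differentiable at A" for k l
    unfolding differentiable_def
    by (rule ex_forward) (erule has_derivative_transform_within_open[OF _ U],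
        use assms in \<open>auto simp: matrix_inv_entry\<close>)
  then have "\<exists>D. \<forall>k l. ((\<lambda>x::real^'n^'n. matrix_inv x $ k $ l) has_derivative D k l) (at A)"
    unfolding differentiable_def by metis
  then obtain D where D: "\<And>k l. ((\<lambda>x::real^'n^'n. matrix_inv x $ k $ l) has_derivative D k l) (at A)"
    by blast
  let ?D = "\<lambda>w. \<chi> k l. D k l w"
  have inv: "(matrix_inv has_derivative ?D) (at A)"
  proof -
    \<comment> \<open>The derivatives of the single entries are reassembled into that of the matrix
      by expanding it in the basis \<open>axis k (axis l 1)\<close>.\<close>
    have der: "((\<lambda>x. \<Sum>k\<in>UNIV. \<Sum>l\<in>UNIV. matrix_inv x $ k $ l *\<^sub>R axis k (axis l (1::real))) has_derivative
        (\<lambda>w. \<Sum>k\<in>UNIV. \<Sum>l\<in>UNIV. D k l w *\<^sub>R axis k (axis l 1))) (at A)"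
      by (intro has_derivative_sum has_derivative_scaleR_left D)
    have mat: "(\<Sum>k\<in>UNIV. \<Sum>l\<in>UNIV. B k l *\<^sub>R axis k (axis l 1)) = (\<chi> k l. B k l)"
      for B :: "'n \<Rightarrow> 'n \<Rightarrow> real"
    proof -
      have ax: "axis k (axis l (1::real)) $ a $ b = (if k = a then if l = b then 1 else 0 else 0)" for k l a b :: 'n
        by (simp add: axis_def)
      have "(\<Sum>k\<in>UNIV. \<Sum>l\<in>UNIV. B k l * (if k = a then if l = b then 1 else 0 else 0)) = B a b" for a b
        by (simp add: if_distrib[of "times _"] sum.If_cases cong: if_cong)
      then show ?thesis by (simp add: vec_eq_iff ax)
    qed
    show ?thesis using der unfolding mat by simp
  qed
  have "((\<lambda>x. x ** matrix_inv x) has_derivative (\<lambda>w. A ** ?D w + w ** matrix_inv A)) (at A)"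
    by (rule bounded_bilinear.FDERIV[OF bounded_bilinear_matrix_mult has_derivative_ident inv])
  moreover have "((\<lambda>x. x ** matrix_inv x) has_derivative (\<lambda>w. 0)) (at A)"
    by (rule has_derivative_transform_within_open[OF has_derivative_const[of "mat 1"] U])
      (use assms in \<open>auto simp: matrix_inv_mult\<close>)
  ultimately have "(\<lambda>w. A ** ?D w + w ** matrix_inv A) = (\<lambda>w. 0)"
    by (rule has_derivative_unique)
  then have eq: "A ** ?D w + w ** matrix_inv A = 0" for w
    by (rule fun_cong)
  have "?D w = - (matrix_inv A ** w ** matrix_inv A)" for w
  proof -
    have "matrix_inv A ** (A ** ?D w + w ** matrix_inv A) = 0" using eq by simp
    then have "?D w + matrix_inv A ** w ** matrix_inv A = 0"
      by (simp add: matrix_add_ldistrib matrix_mul_assoc matrix_inv_mult assms)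
    then show ?thesis by (simp add: eq_neg_iff_add_eq_0)
  qed
  then show ?thesis using inv by simp
qed

lemma has_derivative_matrix_inv:
  fixes f :: "'a::real_normed_vector \<Rightarrow> real^'n^'n"
  assumes "(f has_derivative f') (at x)" "det (f x) \<noteq> 0"
  shows "((\<lambda>x. matrix_inv (f x)) has_derivative (\<lambda>w. - (matrix_inv (f x) ** f' w ** matrix_inv (f x)))) (at x)"
  using diff_chain_at[OF assms(1) has_derivative_matrix_inv_ident[OF assms(2)]] by (simp add: o_def)

text \<open>The derivative of the inverse is a product of the inverse itself and the derivative of
  \<open>f\<close>, so \<open>C^n\<close> regularity of the inverse yields
  \<open>C^(n+1)\<close>.\<close>

lemma Ck_on_matrix_inv:
  fixes f :: "'a::real_normed_vector \<Rightarrow> real^'n^'n"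
  assumes "open U" "\<And>x. x \<in> U \<Longrightarrow> det (f x) \<noteq> 0" "Ck_on n f U"
  shows "Ck_on n (\<lambda>x. matrix_inv (f x)) U"
  using assms(3)
proof (induction n)
  case 0
  then have "continuous_on (f ` U) matrix_inv"
    using assms(2) has_derivative_continuous[OF has_derivative_matrix_inv_ident]
    by (intro continuous_at_imp_continuous_on) auto
  with 0 show ?case using continuous_on_compose2[of "f ` U" matrix_inv U f] by simp
next
  case (Suc n)
  have IH: "Ck_on n (\<lambda>x. matrix_inv (f x)) U" using Suc.IH Ck_on_lower[OF Suc.prems] .
  have neg: "bounded_linear (uminus :: real^'n^'n \<Rightarrow> _)" by (simp add: bounded_linear_minus bounded_linear_ident)
  show ?case
  proof (rule Ck_on_SucI[OF assms(1)])
    show "((\<lambda>x. matrix_inv (f x)) has_derivative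
        (\<lambda>w. - (matrix_inv (f x) ** frechet_derivative f (at x) w ** matrix_inv (f x)))) (at x)"
      if "x \<in> U" for x
      by (rule has_derivative_matrix_inv[OF Ck_on_SucD(1)[OF Suc.prems that] assms(2)[OF that]])
    show "Ck_on n (\<lambda>x. - (matrix_inv (f x) ** frechet_derivative f (at x) v ** matrix_inv (f x))) U" for v
      by (intro Ck_on_linear[OF assms(1) neg] Ck_on_bilinear[OF assms(1) bounded_bilinear_matrix_mult] IH
          Ck_on_SucD(2)[OF Suc.prems])
  qed
qed

section \<open>The Pfaffian form and its invariance\<close>

text \<open>The unnormalised alternation: \<open>wedge k l\<close> is an
  \<open>alt_sum (k + l)\<close> divided by \<open>fact k * fact l\<close>.\<close>

definition alt_sum :: "nat \<Rightarrow> ((nat \<Rightarrow> 'a) \<Rightarrow> real) \<Rightarrow> (nat \<Rightarrow> 'a) \<Rightarrow> real" where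
  "alt_sum n F v = (\<Sum>\<sigma> | \<sigma> permutes {..<n}. of_int (sign \<sigma>) * F (\<lambda>i. v (\<sigma> i)))"

text \<open>If two arguments coincide, reindexing the sum by their transposition preserves each
  value of \<open>F\<close> and reverses each sign, so the sum equals its own negative.\<close>

lemma alternating_form_alt_sum:
  fixes F :: "(nat \<Rightarrow> 'a::real_normed_vector) \<Rightarrow> real"
  assumes dep: "\<And>v w. (\<forall>i<n. v i = w i) \<Longrightarrow> F v = F w"
    and lin: "\<And>v i. i < n \<Longrightarrow> bounded_linear (\<lambda>u. F (v(i := u)))"
  shows "alternating_form n (\<lambda>v. c * alt_sum n F v)"
  unfolding alternating_form_def
proof (intro conjI allI impI)
  fix v w :: "nat \<Rightarrow> 'a" assume vw: "\<forall>i<n. v i = w i"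
  have "F (\<lambda>i. v (\<sigma> i)) = F (\<lambda>i. w (\<sigma> i))" if "\<sigma> permutes {..<n}" for \<sigma>
    using permutes_in_image[OF that] vw by (intro dep) auto
  then show "c * alt_sum n F v = c * alt_sum n F w" by (simp add: alt_sum_def)
next
  fix v :: "nat \<Rightarrow> 'a" and i assume i: "i < n"
  have sg: "bounded_linear (\<lambda>u. of_int (sign \<sigma>) * F (\<lambda>k. (v(i := u)) (\<sigma> k)))"
    if \<sigma>: "\<sigma> permutes {..<n}" for \<sigma>
  proof -
    \<comment> \<open>The vector in slot \<open>i\<close> of \<open>v\<close> reaches
      \<open>F\<close> in slot \<open>inv \<sigma> i\<close>, so linearity of \<open>F\<close> there
      is the one to use.\<close>
    have "(\<lambda>k. (v(i := u)) (\<sigma> k)) = (\<lambda>k. v (\<sigma> k))(inv \<sigma> i := u)" for u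
    proof -
      have "\<sigma> k = i \<longleftrightarrow> k = inv \<sigma> i" for k using permutes_inv_eq[OF \<sigma>, of i k] by metis
      then show ?thesis by (simp add: fun_eq_iff)
    qed
    moreover have "inv \<sigma> i < n"
      using permutes_in_image[OF permutes_inv[OF \<sigma>], of i] i by simp
    ultimately show ?thesis
      using bounded_linear_const_mult[OF lin] by simp
  qed
  show "bounded_linear (\<lambda>u. c * alt_sum n F (v(i := u)))"
    unfolding alt_sum_def by (rule bounded_linear_const_mult, rule bounded_linear_sum, rule sg) simp
next
  fix v :: "nat \<Rightarrow> 'a" and i j
  assume i: "i < n" and j: "j < n" and ij: "i \<noteq> j \<and> v i = v j"
  let ?t = "Transposition.transpose i j"
  have t: "?t permutes {..<n}" using i j by (intro permutes_swap_id) auto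
  have "alt_sum n F v = (\<Sum>\<sigma> | \<sigma> permutes {..<n}. of_int (sign (?t \<circ> \<sigma>)) * F (\<lambda>i. v ((?t \<circ> \<sigma>) i)))"
    unfolding alt_sum_def
    by (rule setum_permutations_compose_left[OF t])
  also have "\<dots> = (\<Sum>\<sigma> | \<sigma> permutes {..<n}. - (of_int (sign \<sigma>) * F (\<lambda>i. v (\<sigma> i))))"
  proof (intro sum.cong refl)
    fix \<sigma> assume "\<sigma> \<in> {\<sigma>. \<sigma> permutes {..<n}}"
    then have "permutation \<sigma>" using permutes_imp_permutation by blast
    then have "sign (?t \<circ> \<sigma>) = - sign \<sigma>"
      using ij by (simp add: sign_compose permutation_swap_id sign_swap_id)
    moreover have "v (?t k) = v k" for k
      using ij by (auto simp: Transposition.transpose_def)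
    ultimately show "of_int (sign (?t \<circ> \<sigma>)) * F (\<lambda>i. v ((?t \<circ> \<sigma>) i)) = - (of_int (sign \<sigma>) * F (\<lambda>i. v (\<sigma> i)))"
      by simp
  qed
  also have "\<dots> = - alt_sum n F v" by (simp add: alt_sum_def sum_negf)
  finally show "c * alt_sum n F v = 0" by simp
qed

lemma alt_sum_2: "alt_sum 2 F v = F v - F (v(0 := v 1, 1 := v 0))"
proof -
  have S: "{..<2::nat} = {0, 1}" by auto
  have *: "finite {1::nat}" "0 \<notin> {1::nat}" by auto
  have v: "(\<lambda>i. v (Transposition.transpose 0 1 i)) = v(0 := v 1, 1 := v 0)"
    by (auto simp: Transposition.transpose_def)
  show ?thesis
    unfolding alt_sum_def S sum_over_permutations_insert[OF *] permutes_sing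
    by (simp add: sign_swap_id sign_id o_def v[simplified])
qed

lemma alt_sum_3:
  "alt_sum 3 (\<lambda>w. G (w 0) (w 1) (w 2)) v =
    G (v 0) (v 1) (v 2) - G (v 0) (v 2) (v 1) - G (v 1) (v 0) (v 2)
    + G (v 1) (v 2) (v 0) + G (v 2) (v 0) (v 1) - G (v 2) (v 1) (v 0)"
proof -
  have S: "{..<3::nat} = {0, 1, 2}" by auto
  have *: "finite {1::nat, 2}" "0 \<notin> {1::nat, 2}" "finite {2::nat}" "1 \<notin> {2::nat}" by auto
  show ?thesis
    unfolding alt_sum_def S sum_over_permutations_insert[OF *(1,2)] sum_over_permutations_insert[OF *(3,4)] permutes_sing
    by (simp add: sign_swap_id permutation_swap_id sign_compose sign_id Transposition.transpose_def)
qed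

text \<open>\<open>G\<close> has no symmetry here, so all 24 signed terms are kept;
  \<open>Pf_eq\<close> later collapses them to three.\<close>

lemma alt_sum_4:
  "alt_sum 4 (\<lambda>w. G (w 0) (w 1) (w 2) (w 3)) v =
    (\<Sum>(p, s) \<leftarrow> [((0,1,2,3),1), ((0,1,3,2),-1), ((0,2,1,3),-1), ((0,2,3,1),1), ((0,3,1,2),1), ((0,3,2,1),-1),
      ((1,0,2,3),-1), ((1,0,3,2),1), ((1,2,0,3),1), ((1,2,3,0),-1), ((1,3,0,2),-1), ((1,3,2,0),1),
      ((2,0,1,3),1), ((2,0,3,1),-1), ((2,1,0,3),-1), ((2,1,3,0),1), ((2,3,0,1),1), ((2,3,1,0),-1),
      ((3,0,1,2),-1), ((3,0,2,1),1), ((3,1,0,2),1), ((3,1,2,0),-1), ((3,2,0,1),-1), ((3,2,1,0),1)].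
      case p of (a, b, c, d) \<Rightarrow> s * G (v a) (v b) (v c) (v d))"
proof -
  have S: "{..<4::nat} = {0, 1, 2, 3}" by auto
  have *: "finite {1::nat, 2, 3}" "0 \<notin> {1::nat, 2, 3}" "finite {2::nat, 3}" "1 \<notin> {2::nat, 3}"
    "finite {3::nat}" "2 \<notin> {3::nat}" by auto
  show ?thesis
    unfolding alt_sum_def S sum_over_permutations_insert[OF *(1,2)] sum_over_permutations_insert[OF *(3,4)]
      sum_over_permutations_insert[OF *(5,6)] permutes_sing
    by (simp add: sign_swap_id permutation_swap_id permutation_compose sign_compose sign_id Transposition.transpose_def)
qed

section \<open>The polarised Pfaffian\<close>

definition bracket :: "mat4 \<Rightarrow> mat4 \<Rightarrow> mat4" where
  "bracket X Y = X ** Y - Y ** X"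

text \<open>The form \<open>Q\<close> of the idea above. On a skew-symmetric matrix
  \<open>pf_form A A\<close> is 8 times the usual Pfaffian.\<close>

definition pf_form :: "mat4 \<Rightarrow> mat4 \<Rightarrow> real" where
  "pf_form A B = (\<Sum>\<tau> | \<tau> permutes (UNIV :: 4 set). of_int (sign \<tau>) * (A $ \<tau> 1 $ \<tau> 2 * B $ \<tau> 3 $ \<tau> 4))"

text \<open>The 24 permutations are grouped by the unordered pair formed by \<open>\<tau> 1\<close>
  and \<open>\<tau> 2\<close>; each of the six groups factors into skew parts of \<open>A\<close>
  and \<open>B\<close>.\<close>

lemma pf_form_expand:
  "pf_form A B =
     (A$1$2 - A$2$1) * (B$3$4 - B$4$3) - (A$1$3 - A$3$1) * (B$2$4 - B$4$2)
   + (A$1$4 - A$4$1) * (B$2$3 - B$3$2) + (A$2$3 - A$3$2) * (B$1$4 - B$4$1)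
   - (A$2$4 - A$4$2) * (B$1$3 - B$3$1) + (A$3$4 - A$4$3) * (B$1$2 - B$2$1)"
proof -
  have *: "finite {2::4, 3, 4}" "1 \<notin> {2::4, 3, 4}" "finite {3::4, 4}" "2 \<notin> {3::4, 4}"
    "finite {4::4}" "3 \<notin> {4::4}" by auto
  show ?thesis
    unfolding pf_form_def UNIV_4 sum_over_permutations_insert[OF *(1,2)] sum_over_permutations_insert[OF *(3,4)]
      sum_over_permutations_insert[OF *(5,6)] permutes_sing
    by (simp add: sign_swap_id permutation_swap_id permutation_compose sign_compose sign_id Transposition.transpose_def
        algebra_simps)
qed

lemma pf_form_commute: "pf_form A B = pf_form B A"
  unfolding pf_form_expand by simp

lemma bounded_bilinear_pf_form: "bounded_bilinear pf_form"
proof -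
  have "bilinear pf_form"
    unfolding bilinear_def
    by (auto intro!: linearI simp: pf_form_expand algebra_simps)
  then show ?thesis by (simp add: bilinear_conv_bounded_bilinear)
qed

text \<open>The sum is the determinant built from the columns \<open>a, b, c, d\<close> of
  \<open>g\<close>. Column selection is multiplication by a 0-1 matrix, whose determinant is the
  Levi-Civita symbol of \<open>(a, b, c, d)\<close>.\<close>

lemma det_columns:
  fixes g :: mat4 and f :: "4 \<Rightarrow> 4" and a b c d :: 4
  defines "f \<equiv> (\<lambda>i. if i = 1 then a else if i = 2 then b else if i = 3 then c else d)"
  shows "(\<Sum>\<tau> | \<tau> permutes (UNIV :: 4 set). of_int (sign \<tau>) *
        (g $ \<tau> 1 $ a * g $ \<tau> 2 $ b * g $ \<tau> 3 $ c * g $ \<tau> 4 $ d)) =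
     det (\<chi> i j. if j = f i then 1 else 0) * det g"
proof -
  have "(\<chi> i j. if j = f i then 1 else 0) ** transpose g = (\<chi> i j. g $ j $ f i)"
    by (simp add: matrix_matrix_mult_def transpose_def if_distrib[of "\<lambda>x. x * _"] cong: if_cong)
  then have *: "det (\<chi> i j. if j = f i then 1 else 0) * det g = det (\<chi> i j. g $ j $ f i)"
    using det_mul[of "\<chi> i j. if j = f i then 1 else 0" "transpose g"] by (simp only: det_transpose)
  have "(\<Prod>i\<in>UNIV. (\<chi> i j. g $ j $ f i) $ i $ p i) = g $ p 1 $ a * g $ p 2 $ b * g $ p 3 $ c * g $ p 4 $ d" for p
    unfolding UNIV_4 f_def by (simp add: mult.assoc)
  then show ?thesis unfolding * by (simp only: det_def)
qed

text \<open>Summing over \<open>\<tau>\<close> first turns the four entries of \<open>g\<close> into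
  a Levi-Civita symbol times \<open>det g\<close>. The case \<open>g = mat 1\<close> of the same
  expansion identifies what remains as \<open>pf_form A B\<close>.\<close>

lemma pf_form_conj:
  "pf_form (g ** A ** transpose g) (g ** B ** transpose g) = det g * pf_form A B"
proof -
  define E :: "4 \<Rightarrow> 4 \<Rightarrow> 4 \<Rightarrow> 4 \<Rightarrow> mat4" where
    "E a b c d = (\<chi> i j. if j = (if i = 1 then a else if i = 2 then b else if i = 3 then c else d) then 1 else 0)" for a b c d
  have gen: "pf_form (g ** A ** transpose g) (g ** B ** transpose g) =
      (\<Sum>a\<in>UNIV. \<Sum>b\<in>UNIV. \<Sum>c\<in>UNIV. \<Sum>d\<in>UNIV. A$a$b * B$c$d * (det (E a b c d) * det g))" for g
  proof -
    have ent: "(g ** M ** transpose g) $ i $ j = (\<Sum>a\<in>UNIV. \<Sum>b\<in>UNIV. g$i$a * M$a$b * g$j$b)" for M i j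
      unfolding matrix_matrix_mult_def transpose_def vec_lambda_beta sum_distrib_right by (rule sum.swap)
    have "pf_form (g ** A ** transpose g) (g ** B ** transpose g) =
       (\<Sum>\<tau> | \<tau> permutes (UNIV :: 4 set). \<Sum>a\<in>UNIV. \<Sum>b\<in>UNIV. \<Sum>c\<in>UNIV. \<Sum>d\<in>UNIV.
          A$a$b * B$c$d * (of_int (sign \<tau>) * (g $ \<tau> 1 $ a * g $ \<tau> 2 $ b * g $ \<tau> 3 $ c * g $ \<tau> 4 $ d)))"
      unfolding pf_form_def ent sum_distrib_right
      unfolding sum_distrib_left
      by (intro sum.cong refl) (simp only: mult_ac)
    also have "\<dots> = (\<Sum>a\<in>UNIV. \<Sum>b\<in>UNIV. \<Sum>c\<in>UNIV. \<Sum>d\<in>UNIV. \<Sum>\<tau> | \<tau> permutes (UNIV :: 4 set).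
          A$a$b * B$c$d * (of_int (sign \<tau>) * (g $ \<tau> 1 $ a * g $ \<tau> 2 $ b * g $ \<tau> 3 $ c * g $ \<tau> 4 $ d)))"
      by (rule trans[OF sum.swap], rule sum.cong[OF refl], rule trans[OF sum.swap], rule sum.cong[OF refl],
          rule trans[OF sum.swap], rule sum.cong[OF refl], rule sum.swap)
    finally show ?thesis by (simp only: sum_distrib_left[symmetric] det_columns E_def)
  qed
  have "pf_form A B = (\<Sum>a\<in>UNIV. \<Sum>b\<in>UNIV. \<Sum>c\<in>UNIV. \<Sum>d\<in>UNIV. A$a$b * B$c$d * det (E a b c d))"
    using gen[of "mat 1"] by (simp only: transpose_mat det_I matrix_mul_lid matrix_mul_rid mult_1_right)
  then show ?thesis
    unfolding gen[of g] by (simp only: sum_distrib_left mult_ac)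
qed

lemma skew_entries:
  fixes M :: mat4
  assumes "transpose M = - M"
  shows "M$1$1 = 0" "M$2$2 = 0" "M$3$3 = 0" "M$4$4 = 0" "M$2$1 = - M$1$2" "M$3$1 = - M$1$3"
    "M$4$1 = - M$1$4" "M$3$2 = - M$2$3" "M$4$2 = - M$2$4" "M$4$3 = - M$3$4"
proof -
  have *: "M$j$i = - M$i$j" for i j
    using arg_cong[OF assms, of "\<lambda>N. N $ i $ j"] by (simp only: transpose_def vec_lambda_beta vector_uminus_component)
  have "M$i$i = 0" for i using *[of i i] by linarith
  then show "M$1$1 = 0" "M$2$2 = 0" "M$3$3 = 0" "M$4$4 = 0" by auto
  show "M$2$1 = - M$1$2" "M$3$1 = - M$1$3"
    "M$4$1 = - M$1$4" "M$3$2 = - M$2$3" "M$4$2 = - M$2$4" "M$4$3 = - M$3$4" by (rule *)+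
qed

lemma bracket_entry: "bracket A B $ i $ j =
   A$i$1 * B$1$j + A$i$2 * B$2$j + A$i$3 * B$3$j + A$i$4 * B$4$j
   - (B$i$1 * A$1$j + B$i$2 * A$2$j + B$i$3 * A$3$j + B$i$4 * A$4$j)"
  by (simp only: bracket_def matrix_matrix_mult_def sum_4 vec_lambda_beta vector_minus_component)

text \<open>The infinitesimal form of invariance under rotations, checked as a polynomial identity
  in the six independent entries of each skew-symmetric matrix.\<close>

lemma pf_form_bracket:
  assumes "transpose A = - A" "transpose B = - B" "transpose C = - C"
  shows "pf_form (bracket A B) C = pf_form A (bracket B C)"
  unfolding pf_form_expand bracket_entry skew_entries[OF assms(1)] skew_entries[OF assms(2)] skew_entries[OF assms(3)]
  by (simp only: mult_zero_left mult_zero_right mult_minus_left mult_minus_right minus_minus add_0_left add_0_right diff_minus_eq_add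
      minus_zero diff_0 diff_0_right add_0) (simp add: algebra_simps)

text \<open>Exchanging the sum over matrix indices with the alternation over arguments lets all
  later computations use \<open>pf_form\<close> in place of entries.\<close>

lemma pf_form_wedge:
  "(\<Sum>\<tau> | \<tau> permutes (UNIV :: 4 set). of_int (sign \<tau>) *
      wedge k l (entry A (\<tau> 1) (\<tau> 2)) (entry B (\<tau> 3) (\<tau> 4)) x v) =
    alt_sum (k + l) (\<lambda>w. pf_form (A x w) (B x (\<lambda>i. w (k + i)))) v / (fact k * fact l)" (is "?L = ?R")
proof -
  have "?L = (\<Sum>\<tau> | \<tau> permutes (UNIV :: 4 set). \<Sum>\<sigma> | \<sigma> permutes {..<k + l}. of_int (sign \<sigma>) * (of_int (sign \<tau>) *
      (A x (\<lambda>i. v (\<sigma> i)) $ \<tau> 1 $ \<tau> 2 * B x (\<lambda>i. v (\<sigma> (k + i))) $ \<tau> 3 $ \<tau> 4)) / (fact k * fact l))"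
    unfolding wedge_def entry_def sum_divide_distrib sum_distrib_left
    by (intro sum.cong refl) (simp add: mult_ac)
  also have "\<dots> = ?R"
    unfolding alt_sum_def pf_form_def sum_divide_distrib sum_distrib_left by (rule sum.swap)
  finally show ?thesis .
qed

lemma mat_wedge_1_1:
  assumes "\<And>v. A x v = a (v 0)" "\<And>v. B x v = b (v 0)"
  shows "mat_wedge 1 1 A B x v = a (v 0) ** b (v 1) - a (v 1) ** b (v 0)"
proof -
  have "wedge 1 1 (entry A i c) (entry B c j) x v = a (v 0) $ i $ c * b (v 1) $ c $ j - a (v 1) $ i $ c * b (v 0) $ c $ j"
    for i c j
    using alt_sum_2[of "\<lambda>w. entry A i c x w * entry B c j x (\<lambda>i. w (1 + i))" v]
    by (simp add: wedge_def alt_sum_def entry_def assms numeral_2_eq_2 mult.assoc)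
  then show ?thesis
    by (simp add: mat_wedge_def vec_eq_iff matrix_matrix_mult_def sum_subtractf)
qed

section \<open>Forms on the simplicial manifold\<close>

interpretation mm: bounded_bilinear "(**) :: mat4 \<Rightarrow> mat4 \<Rightarrow> mat4"
  by (rule bounded_bilinear_matrix_mult)

interpretation pf: bounded_bilinear pf_form
  by (rule bounded_bilinear_pf_form)

lemma bounded_bilinear_bracket: "bounded_bilinear bracket"
proof -
  have "bilinear bracket"
    unfolding bilinear_def bracket_def
    by (auto intro!: linearI simp: mm.add_left mm.add_right mm.scaleR_left mm.scaleR_right scaleR_diff_right)
  then show ?thesis by (simp add: bilinear_conv_bounded_bilinear)
qed

interpretation br: bounded_bilinear bracket
  by (rule bounded_bilinear_bracket)

lemma bracket_swap: "bracket Y X = - bracket X Y"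
  by (simp add: bracket_def)

lemma bracket_jacobi: "bracket X (bracket Y Z) - bracket Y (bracket X Z) + bracket Z (bracket X Y) = 0"
  by (simp add: bracket_def mm.diff_left mm.diff_right matrix_mul_assoc)

text \<open>The adjoint action when \<open>g\<close> is in \<open>SO4\<close>; the transpose keeps
  it polynomial in \<open>g\<close> elsewhere.\<close>

definition conj_by :: "mat4 \<Rightarrow> mat4 \<Rightarrow> mat4" where
  "conj_by g X = g ** X ** transpose g"

lemma bounded_linear_conj_by: "bounded_linear (conj_by g)"
  unfolding conj_by_def
  by (rule bounded_linear_compose[OF mm.bounded_linear_left mm.bounded_linear_right])

lemma conj_by_add: "conj_by g (X + Y) = conj_by g X + conj_by g Y"
  and conj_by_diff: "conj_by g (X - Y) = conj_by g X - conj_by g Y"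
  and conj_by_zero: "conj_by g 0 = 0"
  and conj_by_scaleR: "conj_by g (c *\<^sub>R X) = c *\<^sub>R conj_by g X"
  and conj_by_sum: "conj_by g (sum f I) = (\<Sum>i\<in>I. conj_by g (f i))"
  using bounded_linear.linear[OF bounded_linear_conj_by[of g]]
  by (simp_all add: linear_add linear_diff linear_0 linear_cmul linear_sum)

lemma SO4_D:
  assumes "g \<in> SO4"
  shows "transpose g ** g = mat 1" "g ** transpose g = mat 1" "det g = 1" "matrix_inv g = transpose g"
proof -
  show 1: "transpose g ** g = mat 1" "g ** transpose g = mat 1" "det g = 1"
    using assms by (auto simp: SO4_def orthogonal_matrix_def)
  have "matrix_inv g = transpose g ** (g ** matrix_inv g)"
    using 1 by (simp add: matrix_mul_assoc)
  then show "matrix_inv g = transpose g" using 1 by (simp add: matrix_inv_mult)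
qed

lemma SO4_transpose: "g \<in> SO4 \<Longrightarrow> transpose g \<in> SO4"
  by (simp add: SO4_def orthogonal_matrix_transpose)

lemma SO4_mult: "g \<in> SO4 \<Longrightarrow> h \<in> SO4 \<Longrightarrow> g ** h \<in> SO4"
  by (simp add: SO4_def orthogonal_matrix_mul det_mul)

lemma conj_by_mult:
  assumes "g \<in> SO4"
  shows "conj_by g X ** conj_by g Y = conj_by g (X ** Y)"
proof -
  have "conj_by g X ** conj_by g Y = g ** X ** (transpose g ** g) ** Y ** transpose g"
    by (simp add: conj_by_def matrix_mul_assoc)
  then show ?thesis using SO4_D[OF assms] by (simp add: conj_by_def matrix_mul_assoc)
qed

lemma bracket_conj_by: "g \<in> SO4 \<Longrightarrow> bracket (conj_by g X) (conj_by g Y) = conj_by g (bracket X Y)"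
  by (simp add: bracket_def conj_by_mult conj_by_diff)

lemma pf_form_conj_by: "g \<in> SO4 \<Longrightarrow> pf_form (conj_by g X) (conj_by g Y) = pf_form X Y"
  by (simp add: conj_by_def pf_form_conj SO4_D)

lemma conj_by_transpose_cancel:
  assumes "g \<in> SO4"
  shows "conj_by g (conj_by (transpose g) X) = X"
proof -
  have "conj_by g (conj_by (transpose g) X) = (g ** transpose g) ** X ** (g ** transpose g)"
    by (simp add: conj_by_def matrix_mul_assoc)
  then show ?thesis using SO4_D[OF assms] by simp
qed

lemma transpose_add: "transpose (A + B) = transpose A + transpose (B :: mat4)"
  and transpose_diff: "transpose (A - B) = transpose A - transpose (B :: mat4)"
  by (simp_all add: transpose_def vec_eq_iff)

lemma skew_conj_by: "transpose X = - X \<Longrightarrow> transpose (conj_by g X) = - conj_by g X"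
  by (simp add: conj_by_def matrix_transpose_mul mm.minus_left mm.minus_right matrix_mul_assoc)

lemma skew_bracket:
  "transpose X = - X \<Longrightarrow> transpose Y = - Y \<Longrightarrow> transpose (bracket X Y) = - bracket X Y"
  by (simp add: bracket_def transpose_diff matrix_transpose_mul mm.minus_left mm.minus_right)

lemma skew_add:
  fixes X Y :: mat4
  shows "transpose X = - X \<Longrightarrow> transpose Y = - Y \<Longrightarrow> transpose (X + Y) = - (X + Y)"
  by (simp add: transpose_add)

text \<open>The cyclic sum of \<open>pf_form X (bracket Y Z)\<close>. It is alternating on all of
  \<open>mat4\<close>, so products such as \<open>X ** Y\<close>, which arise on differentiating,
  may be inserted before they combine into brackets.\<close>

definition pf_triple :: "mat4 \<Rightarrow> mat4 \<Rightarrow> mat4 \<Rightarrow> real" where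
  "pf_triple X Y Z = pf_form X (bracket Y Z) - pf_form Y (bracket X Z) + pf_form Z (bracket X Y)"

lemma pf_triple_diff:
  "pf_triple (X - X') Y Z = pf_triple X Y Z - pf_triple X' Y Z"
  "pf_triple X (Y - Y') Z = pf_triple X Y Z - pf_triple X Y' Z"
  "pf_triple X Y (Z - Z') = pf_triple X Y Z - pf_triple X Y Z'"
  by (simp_all add: pf_triple_def pf.diff_left pf.diff_right br.diff_left br.diff_right)

lemma pf_triple_minus:
  "pf_triple (- X) Y Z = - pf_triple X Y Z"
  "pf_triple X (- Y) Z = - pf_triple X Y Z"
  "pf_triple X Y (- Z) = - pf_triple X Y Z"
  by (simp_all add: pf_triple_def pf.minus_left pf.minus_right br.minus_left br.minus_right)

lemma pf_triple_swap:
  "pf_triple Y X Z = - pf_triple X Y Z" "pf_triple X Z Y = - pf_triple X Y Z"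
  using bracket_swap[of X Y] bracket_swap[of Y Z] bracket_swap[of X Z]
  by (simp_all add: pf_triple_def pf.minus_right)

lemma pf_triple_conj_by:
  "g \<in> SO4 \<Longrightarrow> pf_triple (conj_by g X) (conj_by g Y) (conj_by g Z) = pf_triple X Y Z"
  by (simp add: pf_triple_def bracket_conj_by pf_form_conj_by)

lemma pf_form_bracket_rotate:
  assumes "transpose X = - X" "transpose Y = - Y" "transpose Z = - Z"
  shows "pf_form X (bracket Y Z) = pf_form Z (bracket X Y)"
    "pf_form Y (bracket X Z) = - pf_form Z (bracket X Y)"
proof -
  show 1: "pf_form X (bracket Y Z) = pf_form Z (bracket X Y)"
    using pf_form_bracket[OF assms] pf_form_commute[of Z] by simp
  show "pf_form Y (bracket X Z) = - pf_form Z (bracket X Y)"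
    using pf_form_bracket[OF assms(2,1,3)] bracket_swap[of X Y] pf_form_commute[of Z]
    by (simp add: pf.minus_left)
qed

text \<open>By invariance of \<open>pf_form\<close> the three cyclic terms coincide.\<close>

lemma pf_triple_skew:
  assumes "transpose X = - X" "transpose Y = - Y" "transpose Z = - Z"
  shows "pf_triple X Y Z = 3 * pf_form X (bracket Y Z)"
  using pf_form_bracket_rotate[OF assms] by (simp add: pf_triple_def)

text \<open>Invariance moves \<open>W\<close> out of each bracket, and the Jacobi identity remains
  in the other argument.\<close>

lemma pf_form_bracket_bracket:
  assumes "transpose W = - W" "transpose X = - X" "transpose Y = - Y" "transpose Z = - Z"
  shows "pf_form (bracket W X) (bracket Y Z) - pf_form (bracket W Y) (bracket X Z)
    + pf_form (bracket W Z) (bracket X Y) = 0"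
proof -
  have "pf_form (bracket W X) (bracket Y Z) - pf_form (bracket W Y) (bracket X Z)
      + pf_form (bracket W Z) (bracket X Y)
    = pf_form W (bracket X (bracket Y Z) - bracket Y (bracket X Z) + bracket Z (bracket X Y))"
    using assms by (simp add: pf_form_bracket skew_bracket pf.add_right pf.diff_right)
  then show ?thesis by (simp add: bracket_jacobi pf.zero_right)
qed

section \<open>Entrywise calculus in the space of sequences\<close>

lemma bounded_linear_apply_bcontfun:
  "bounded_linear (\<lambda>x :: 'b::real_normed_vector bseq. apply_bcontfun x i)"
  by (rule bounded_linear_intro[where K=1]) (simp_all add: norm_bounded)

lemma bounded_linear_fin_seq_single:
  "bounded_linear (\<lambda>u :: 'b::real_normed_vector. fin_seq {i} (\<lambda>_. u))"
proof (rule bounded_linear_intro[where K=1])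
  show "norm (fin_seq {i} (\<lambda>_. u)) \<le> norm u * 1" for u :: 'b
    by (rule norm_bound) (simp add: apply_fin_seq)
qed (auto intro!: bcontfun_eqI simp: apply_fin_seq)

lemma apply_bcontfun_sum:
  "apply_bcontfun (\<Sum>i\<in>I. f i :: 'b::real_normed_vector bseq) j = (\<Sum>i\<in>I. apply_bcontfun (f i) j)"
  by (rule linear_sum[OF bounded_linear.linear[OF bounded_linear_apply_bcontfun]])

lemma fin_seq_eq_sum:
  assumes "finite I"
  shows "fin_seq I f = (\<Sum>i\<in>I. fin_seq {i} (\<lambda>_. f i))"
  using assms by (auto intro!: bcontfun_eqI simp: apply_fin_seq apply_bcontfun_sum)

text \<open>A finite tuple is a finite sum of one-entry sequences, each linear in its entry.\<close>

lemma has_derivative_fin_seq: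
  assumes "finite I" "\<And>i. i \<in> I \<Longrightarrow> ((\<lambda>x. f x i) has_derivative (\<lambda>w. f' w i)) (at x)"
  shows "((\<lambda>x. fin_seq I (f x)) has_derivative (\<lambda>w. fin_seq I (f' w))) (at x)"
  unfolding fin_seq_eq_sum[OF assms(1)]
  by (intro has_derivative_sum bounded_linear.has_derivative[OF bounded_linear_fin_seq_single] assms(2))

lemmas has_derivative_apply_bcontfun =
  bounded_linear.has_derivative[OF bounded_linear_apply_bcontfun]

lemma Ck_on_apply_bcontfun:
  assumes "open U" "Ck_on n f U"
  shows "Ck_on n (\<lambda>x. apply_bcontfun (f x :: 'b::real_normed_vector bseq) i) U"
  by (rule Ck_on_linear[OF assms(1) bounded_linear_apply_bcontfun assms(2)])

lemma Ck_on_diff: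
  assumes "open U" "Ck_on n f U" "Ck_on n g U"
  shows "Ck_on n (\<lambda>x. f x - g x) U"
  using Ck_on_add[OF assms(1,2) Ck_on_linear[OF assms(1) bounded_linear_minus[OF bounded_linear_ident] assms(3)]]
  by simp

text \<open>Turns equations that hold on \<open>M\<close> into linear conditions on tangent vectors:
  \<open>f\<close> is constant along each curve in \<open>M\<close>, so \<open>f'\<close> kills its
  velocity, and linearity extends this to the span.\<close>

lemma tangent_space_const:
  assumes "\<And>y. y \<in> M \<Longrightarrow> f y = c" "(f has_derivative f') (at x)" "u \<in> tangent_space M x"
  shows "f' u = 0"
proof -
  have lin: "linear f'" using assms(2) by (simp add: has_derivative_linear)
  have "subspace {u. f' u = 0}"
    using lin by (auto simp: subspace_def linear_0 linear_add linear_cmul)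
  moreover have "f' u = 0" if \<gamma>: "\<gamma> 0 = x" "\<gamma> ` {0..1} \<subseteq> M"
    "(\<gamma> has_vector_derivative u) (at 0 within {0..1})" for \<gamma> :: "real \<Rightarrow> 'a" and u
  proof -
    have "(f has_derivative f') (at (\<gamma> 0) within \<gamma> ` {0..1})"
      using assms(2) \<gamma>(1) has_derivative_at_withinI by blast
    then have "(f \<circ> \<gamma> has_derivative f' \<circ> (\<lambda>t. t *\<^sub>R u)) (at 0 within {0..1})"
      using diff_chain_within \<gamma>(3) unfolding has_vector_derivative_def by blast
    then have "(f \<circ> \<gamma> has_vector_derivative f' u) (at 0 within {0..1})"
      using lin by (simp add: has_vector_derivative_def o_def linear_cmul)
    moreover have "(f \<circ> \<gamma> has_vector_derivative 0) (at 0 within {0..1})"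
      by (rule has_vector_derivative_transform[OF _ _ has_vector_derivative_const[of c]])
        (use \<gamma>(2) assms(1) in \<open>auto simp: image_subset_iff\<close>)
    \<comment> \<open>The curves start at the endpoint 0 of their interval, so uniqueness of
      one-sided derivatives is used.\<close>
    ultimately show ?thesis
      using vector_derivative_unique_within_closed_interval[of 0 1 0 "f \<circ> \<gamma>"] by auto
  qed
  ultimately show ?thesis
    using assms(3) unfolding tangent_space_def
    by (auto elim!: span_induct[where P="\<lambda>u. f' u = 0"])
qed

section \<open>Maurer-Cartan forms, and the two explicit forms written through them\<close>

definition lmc :: "nat \<Rightarrow> mat4 bseq \<Rightarrow> mat4 bseq \<Rightarrow> mat4" where
  "lmc i x u = matrix_inv (x i) ** u i"

definition rmc :: "nat \<Rightarrow> mat4 bseq \<Rightarrow> mat4 bseq \<Rightarrow> mat4" where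
  "rmc i x u = u i ** matrix_inv (x i)"

text \<open>Obtained by differentiating \<open>transpose g ** g = mat 1\<close> along
  \<open>u\<close>.\<close>

lemma skew_lmc:
  assumes x: "x \<in> NG q" and i: "i \<in> {1..q}" and u: "u \<in> tangent_space (NG q) x"
  shows "transpose (lmc i x u) = - lmc i x u"
proof -
  have xi: "x i \<in> SO4" using x i by (auto simp: NG_def)
  have "((\<lambda>y. transpose (apply_bcontfun y i) ** apply_bcontfun y i) has_derivative
      (\<lambda>u. transpose (x i) ** u i + transpose (u i) ** x i)) (at x)"
    by (intro mm.FDERIV bounded_linear.has_derivative[OF bounded_linear_transpose]
        has_derivative_apply_bcontfun has_derivative_ident)
  then have "transpose (x i) ** u i + transpose (u i) ** x i = 0"
    using i by (intro tangent_space_const[OF _ _ u, where c="mat 1"]) (auto simp: NG_def SO4_D)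
  then have "transpose (u i) ** x i = - (transpose (x i) ** u i)"
    by (simp only: eq_neg_iff_add_eq_0 add.commute)
  then show ?thesis
    by (simp only: lmc_def SO4_D[OF xi] matrix_transpose_mul transpose_transpose)
qed

lemma rmc_eq_conj_by:
  fixes x :: "mat4 bseq"
  assumes "x i \<in> SO4"
  shows "rmc i x u = conj_by (x i) (lmc i x u)"
  using SO4_D[OF assms] by (simp add: rmc_def lmc_def conj_by_def matrix_mul_assoc)

lemma lmc_eq_conj_by:
  fixes x :: "mat4 bseq"
  assumes "x i \<in> SO4"
  shows "lmc i x u = conj_by (transpose (x i)) (rmc i x u)"
  using SO4_D[OF assms] by (simp add: rmc_def lmc_def conj_by_def matrix_mul_assoc[symmetric])

lemma skew_rmc:
  assumes "x \<in> NG q" "i \<in> {1..q}" "u \<in> tangent_space (NG q) x"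
  shows "transpose (rmc i x u) = - rmc i x u"
proof -
  have "x i \<in> SO4" using assms by (auto simp: NG_def)
  then show ?thesis by (simp only: rmc_eq_conj_by skew_conj_by[OF skew_lmc[OF assms]])
qed

lemma bounded_linear_lmc: "bounded_linear (lmc i x)"
  unfolding lmc_def
  by (rule bounded_linear_compose[OF mm.bounded_linear_right bounded_linear_apply_bcontfun])

lemma bounded_linear_rmc: "bounded_linear (rmc i x)"
  unfolding rmc_def
  by (rule bounded_linear_compose[OF mm.bounded_linear_left bounded_linear_apply_bcontfun])

text \<open>Antisymmetrised in \<open>u\<close> and \<open>w\<close> this is the Maurer-Cartan
  equation. For \<open>rmc\<close> the factors come in the opposite order, which reverses the sign
  of the bracket.\<close>

lemma has_derivative_lmc:
  fixes x :: "mat4 bseq"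
  assumes "det (x i) \<noteq> 0"
  shows "((\<lambda>y. lmc i y w) has_derivative (\<lambda>u. - (lmc i x u ** lmc i x w))) (at x)"
  unfolding lmc_def
  by (rule has_derivative_eq_rhs[OF bounded_linear.has_derivative[OF mm.bounded_linear_left
          has_derivative_matrix_inv[OF has_derivative_apply_bcontfun[OF has_derivative_ident]]]])
    (use assms in \<open>auto simp: mm.minus_left matrix_mul_assoc\<close>)

lemma has_derivative_rmc:
  fixes x :: "mat4 bseq"
  assumes "det (x i) \<noteq> 0"
  shows "((\<lambda>y. rmc i y w) has_derivative (\<lambda>u. - (rmc i x w ** rmc i x u))) (at x)"
  unfolding rmc_def
  by (rule has_derivative_eq_rhs[OF bounded_linear.has_derivative[OF mm.bounded_linear_right
          has_derivative_matrix_inv[OF has_derivative_apply_bcontfun[OF has_derivative_ident]]]])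
    (use assms in \<open>auto simp: mm.minus_right matrix_mul_assoc\<close>)

text \<open>Provides the neighbourhood of \<open>NG n\<close> on which forms built from matrix
  inverses are smooth.\<close>

lemma open_det_nonzero: "open {x :: mat4 bseq. \<forall>i\<in>{1..n::nat}. det (x i) \<noteq> 0}"
proof -
  have ent: "(\<lambda>x :: mat4 bseq. x i $ a $ b) differentiable at x" for i a b x
    by (intro bounded_linear_imp_differentiable bounded_linear_compose[OF bounded_linear_vec_nth]
        bounded_linear_apply_bcontfun)
  have "continuous_on UNIV (\<lambda>x :: mat4 bseq. det (x i))" for i
    by (intro continuous_at_imp_continuous_on ballI differentiable_imp_continuous_within differentiable_det ent)
  then have "open ((\<lambda>x :: mat4 bseq. det (x i)) -` (- {0}))" for i
    by (intro open_vimage) auto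
  then have "open (\<Inter>i\<in>{1..n}. (\<lambda>x :: mat4 bseq. det (x i)) -` (- {0}))"
    by (intro open_INT) auto
  moreover have "(\<Inter>i\<in>{1..n}. (\<lambda>x :: mat4 bseq. det (x i)) -` (- {0})) = {x :: mat4 bseq. \<forall>i\<in>{1..n}. det (x i) \<noteq> 0}"
    by auto
  ultimately show ?thesis by simp
qed

lemma Ck_on_lmc:
  assumes "open U" "\<And>x. x \<in> U \<Longrightarrow> det (apply_bcontfun x i) \<noteq> 0"
  shows "Ck_on n (\<lambda>x. lmc i x u) U"
  unfolding lmc_def
  by (intro Ck_on_linear[OF assms(1) mm.bounded_linear_left] Ck_on_matrix_inv assms
      Ck_on_apply_bcontfun Ck_on_ident)

lemma Ck_on_rmc:
  assumes "open U" "\<And>x. x \<in> U \<Longrightarrow> det (apply_bcontfun x i) \<noteq> 0"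
  shows "Ck_on n (\<lambda>x. rmc i x u) U"
  unfolding rmc_def
  by (intro Ck_on_linear[OF assms(1) mm.bounded_linear_right] Ck_on_matrix_inv assms
      Ck_on_apply_bcontfun Ck_on_ident)

text \<open>Both summands of \<open>E13\<close> contribute equally because \<open>pf_form\<close> is
  symmetric: each alternation is twice \<open>pf_triple\<close>, divided by
  \<open>fact 1 * fact 2\<close>. The \<open>alt_sum\<close> shape shows that the form is
  alternating, the \<open>pf_triple\<close> shape is the one to compute with.\<close>

lemma E13_alt_sum:
  "E13 x v = 1 / (192 * pi ^ 2) *
     alt_sum 3 (\<lambda>w. pf_form (lmc 1 x (w 0)) (bracket (lmc 1 x (w 1)) (lmc 1 x (w 2)))) v"
  and E13_triple:
  "E13 x v = 1 / (96 * pi ^ 2) * pf_triple (lmc 1 x (v 0)) (lmc 1 x (v 1)) (lmc 1 x (v 2))"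
proof -
  let ?L = "lmc 1 x"
  have L: "left_MC 1 x v = ?L (v 0)" for v by (simp add: left_MC_def lmc_def)
  have B: "mat_wedge 1 1 (left_MC 1) (left_MC 1) x v = bracket (?L (v 0)) (?L (v 1))" for v
    by (subst mat_wedge_1_1[where A="left_MC 1" and B="left_MC 1" and x=x and a="?L" and b="?L", OF L L]) (simp add: bracket_def)
  have e: "E13 x v = 1 / (192 * pi ^ 2) *
     (alt_sum (1 + 2) (\<lambda>w. pf_form (left_MC 1 x w) (mat_wedge 1 1 (left_MC 1) (left_MC 1) x (\<lambda>i. w (1 + i)))) v / (fact 1 * fact 2)
     + alt_sum (2 + 1) (\<lambda>w. pf_form (mat_wedge 1 1 (left_MC 1) (left_MC 1) x w) (left_MC 1 x (\<lambda>i. w (2 + i)))) v / (fact 2 * fact 1))"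
    unfolding E13_def Let_def distrib_left sum.distrib pf_form_wedge by simp
  have a1: "alt_sum 3 (\<lambda>w. pf_form (?L (w 0)) (bracket (?L (w 1)) (?L (w 2)))) v
      = 2 * pf_triple (?L (v 0)) (?L (v 1)) (?L (v 2))" for v
    using bracket_swap[of "?L (v 1)" "?L (v 0)"] bracket_swap[of "?L (v 2)" "?L (v 0)"] bracket_swap[of "?L (v 2)" "?L (v 1)"]
    by (subst alt_sum_3[of "\<lambda>a b c. pf_form (?L a) (bracket (?L b) (?L c))"]) (simp add: pf_triple_def pf.minus_right)
  have a2: "alt_sum 3 (\<lambda>w. pf_form (bracket (?L (w 0)) (?L (w 1))) (?L (w 2))) v
      = 2 * pf_triple (?L (v 0)) (?L (v 1)) (?L (v 2))" for v
    using bracket_swap[of "?L (v 1)" "?L (v 0)"] bracket_swap[of "?L (v 2)" "?L (v 0)"] bracket_swap[of "?L (v 2)" "?L (v 1)"]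
    by (subst alt_sum_3[of "\<lambda>a b c. pf_form (bracket (?L a) (?L b)) (?L c)"])
       (simp add: pf_triple_def pf.minus_left pf.minus_right pf_form_commute)
  show 2: "E13 x v = 1 / (96 * pi ^ 2) * pf_triple (?L (v 0)) (?L (v 1)) (?L (v 2))"
    unfolding e L B using a1[of v] a2[of v] by (simp add: numeral_3_eq_3 numeral_2_eq_2)
  show "E13 x v = 1 / (192 * pi ^ 2) * alt_sum 3 (\<lambda>w. pf_form (?L (w 0)) (bracket (?L (w 1)) (?L (w 2)))) v"
    unfolding 2 a1 by simp
qed

text \<open>Since \<open>pf_form\<close> is symmetric and the wedge of 1-forms antisymmetric, the
  subtracted summand is the negative of the first, which turns 1/64 into 1/32.\<close>

lemma E22_alt_sum:
  "E22 x v = - 1 / (32 * pi ^ 2) * alt_sum 2 (\<lambda>w. pf_form (lmc 1 x (w 0)) (rmc 2 x (w 1))) v"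
  and E22_eq:
  "E22 x v = - 1 / (32 * pi ^ 2) * (pf_form (lmc 1 x (v 0)) (rmc 2 x (v 1)) - pf_form (lmc 1 x (v 1)) (rmc 2 x (v 0)))"
proof -
  let ?L = "lmc 1 x" and ?R = "rmc 2 x"
  have L: "left_MC 1 x v = ?L (v 0)" and R: "right_MC 2 x v = ?R (v 0)" for v
    by (simp_all add: left_MC_def lmc_def right_MC_def rmc_def)
  have e: "E22 x v = - 1 / (64 * pi ^ 2) *
     (alt_sum (1 + 1) (\<lambda>w. pf_form (left_MC 1 x w) (right_MC 2 x (\<lambda>i. w (1 + i)))) v / (fact 1 * fact 1)
     - alt_sum (1 + 1) (\<lambda>w. pf_form (right_MC 2 x w) (left_MC 1 x (\<lambda>i. w (1 + i)))) v / (fact 1 * fact 1))"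
    unfolding E22_def Let_def right_diff_distrib sum_subtractf pf_form_wedge by simp
  show 2: "E22 x v = - 1 / (32 * pi ^ 2) * (pf_form (?L (v 0)) (?R (v 1)) - pf_form (?L (v 1)) (?R (v 0)))"
    unfolding e L R one_add_one alt_sum_2 by (simp add: pf_form_commute field_simps)
  show "E22 x v = - 1 / (32 * pi ^ 2) * alt_sum 2 (\<lambda>w. pf_form (?L (w 0)) (?R (w 1))) v"
    unfolding 2 alt_sum_2 by simp
qed

lemma smooth_form_E13: "smooth_form 3 (NG 1) E13"
  unfolding smooth_form_def
proof (intro exI conjI ballI allI)
  let ?U = "{x :: mat4 bseq. \<forall>i\<in>{1..1::nat}. det (x i) \<noteq> 0}"
  show U: "open ?U" by (rule open_det_nonzero)
  show "NG 1 \<subseteq> ?U" by (auto simp: NG_def SO4_D)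
  show "alternating_form 3 (E13 x)" for x
    unfolding E13_alt_sum[abs_def]
  proof (rule alternating_form_alt_sum)
    fix v :: "nat \<Rightarrow> mat4 bseq" and i :: nat assume "i < 3"
    then consider "i = 0" | "i = 1" | "i = 2" by linarith
    then show "bounded_linear (\<lambda>u. pf_form (lmc 1 x ((v(i := u)) 0)) (bracket (lmc 1 x ((v(i := u)) 1)) (lmc 1 x ((v(i := u)) 2))))"
      by cases (simp_all, (intro bounded_linear_compose[OF pf.bounded_linear_left]
        bounded_linear_compose[OF pf.bounded_linear_right]
        bounded_linear_compose[OF br.bounded_linear_left]
        bounded_linear_compose[OF br.bounded_linear_right] bounded_linear_lmc)+)
  qed auto
  show "Ck_on n (\<lambda>x. E13 x v) ?U" for v n
    unfolding E13_triple pf_triple_def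
    by (intro Ck_on_linear[OF U bounded_linear_mult_right] Ck_on_add Ck_on_diff
       Ck_on_bilinear[OF U bounded_bilinear_pf_form] Ck_on_bilinear[OF U bounded_bilinear_bracket] Ck_on_lmc U) auto
qed

lemma smooth_form_E22: "smooth_form 2 (NG 2) E22"
  unfolding smooth_form_def
proof (intro exI conjI ballI allI)
  let ?U = "{x :: mat4 bseq. \<forall>i\<in>{1..2::nat}. det (x i) \<noteq> 0}"
  show U: "open ?U" by (rule open_det_nonzero)
  show "NG 2 \<subseteq> ?U" by (auto simp: NG_def SO4_D)
  show "alternating_form 2 (E22 x)" for x
    unfolding E22_alt_sum[abs_def]
  proof (rule alternating_form_alt_sum)
    fix v :: "nat \<Rightarrow> mat4 bseq" and i :: nat assume "i < 2"
    then consider "i = 0" | "i = 1" by linarith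
    then show "bounded_linear (\<lambda>u. pf_form (lmc 1 x ((v(i := u)) 0)) (rmc 2 x ((v(i := u)) 1)))"
      by cases (simp_all, (intro bounded_linear_compose[OF pf.bounded_linear_left]
        bounded_linear_compose[OF pf.bounded_linear_right] bounded_linear_lmc bounded_linear_rmc)+)
  qed auto
  show "Ck_on n (\<lambda>x. E22 x v) ?U" for v n
    unfolding E22_eq
    by (intro Ck_on_linear[OF U bounded_linear_mult_right] Ck_on_diff
       Ck_on_bilinear[OF U bounded_bilinear_pf_form] Ck_on_lmc Ck_on_rmc U) auto
qed

section \<open>The cocycle conditions\<close>

lemma has_derivative_pf_triple:
  assumes "(X has_derivative X') (at x)" "(Y has_derivative Y') (at x)" "(Z has_derivative Z') (at x)"
  shows "((\<lambda>y. pf_triple (X y) (Y y) (Z y)) has_derivative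
    (\<lambda>u. pf_triple (X' u) (Y x) (Z x) + pf_triple (X x) (Y' u) (Z x) + pf_triple (X x) (Y x) (Z' u))) (at x)"
proof -
  note d = pf.FDERIV br.FDERIV assms
  have "((\<lambda>y. pf_triple (X y) (Y y) (Z y)) has_derivative (\<lambda>u.
      pf_form (X x) (bracket (Y x) (Z' u) + bracket (Y' u) (Z x)) + pf_form (X' u) (bracket (Y x) (Z x))
      - (pf_form (Y x) (bracket (X x) (Z' u) + bracket (X' u) (Z x)) + pf_form (Y' u) (bracket (X x) (Z x)))
      + (pf_form (Z x) (bracket (X x) (Y' u) + bracket (X' u) (Y x)) + pf_form (Z' u) (bracket (X x) (Y x))))) (at x)"
    unfolding pf_triple_def by (intro has_derivative_add has_derivative_diff d)
  then show ?thesis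
    by (rule has_derivative_eq_rhs) (simp add: pf_triple_def pf.add_right fun_eq_iff)
qed

lemma NG_SO4: "x \<in> NG q \<Longrightarrow> i \<in> {1..q} \<Longrightarrow> apply_bcontfun x i \<in> SO4"
  by (auto simp: NG_def)

lemma has_derivative_E13:
  assumes "det (apply_bcontfun x 1) \<noteq> 0"
  shows "((\<lambda>y. E13 y w) has_derivative (\<lambda>u. - 1 / (96 * pi ^ 2) *
     (pf_triple (lmc 1 x u ** lmc 1 x (w 0)) (lmc 1 x (w 1)) (lmc 1 x (w 2))
    + pf_triple (lmc 1 x (w 0)) (lmc 1 x u ** lmc 1 x (w 1)) (lmc 1 x (w 2))
    + pf_triple (lmc 1 x (w 0)) (lmc 1 x (w 1)) (lmc 1 x u ** lmc 1 x (w 2))))) (at x)"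
  unfolding E13_triple
  by (rule has_derivative_eq_rhs[OF has_derivative_mult_right[OF has_derivative_pf_triple[OF
          has_derivative_lmc[OF assms] has_derivative_lmc[OF assms] has_derivative_lmc[OF assms]]]])
    (simp add: fun_eq_iff pf_triple_minus diff_divide_distrib add_divide_distrib)

lemma has_derivative_E22:
  assumes "det (apply_bcontfun x 1) \<noteq> 0" "det (apply_bcontfun x 2) \<noteq> 0"
  shows "((\<lambda>y. E22 y w) has_derivative (\<lambda>u. 1 / (32 * pi ^ 2) *
     (pf_form (lmc 1 x u ** lmc 1 x (w 0)) (rmc 2 x (w 1)) + pf_form (lmc 1 x (w 0)) (rmc 2 x (w 1) ** rmc 2 x u)
    - pf_form (lmc 1 x u ** lmc 1 x (w 1)) (rmc 2 x (w 0)) - pf_form (lmc 1 x (w 1)) (rmc 2 x (w 0) ** rmc 2 x u)))) (at x)"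
  unfolding E22_eq
  by (rule has_derivative_eq_rhs[OF has_derivative_mult_right[OF has_derivative_diff[OF
          pf.FDERIV[OF has_derivative_lmc[OF assms(1)] has_derivative_rmc[OF assms(2)]]
          pf.FDERIV[OF has_derivative_lmc[OF assms(1)] has_derivative_rmc[OF assms(2)]]]]])
    (simp add: fun_eq_iff pf.minus_left pf.minus_right algebra_simps)

lemma d_ver_E13: "form_eq (NG 1) (d_ver 1 3 E13) (\<lambda>x v. 0)"
  unfolding form_eq_def
proof (intro ballI allI impI)
  fix x :: "mat4 bseq" and v :: "nat \<Rightarrow> mat4 bseq" assume x: "x \<in> NG 1" and v: "\<forall>i. v i \<in> tangent_space (NG 1) x"
  define X where "X i = lmc 1 x (v i)" for i :: nat
  have sk: "transpose (X i) = - X i" for i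
    unfolding X_def using skew_lmc[OF x] v by simp
  have det: "det (apply_bcontfun x 1) \<noteq> 0" using NG_SO4[OF x] SO4_D by simp
  have S: "(\<Sum>i\<le>3. f i) = f 0 + f 1 + f 2 + f 3" for f :: "nat \<Rightarrow> real"
    by (simp add: numeral_3_eq_3 numeral_2_eq_2)
  let ?T = pf_triple
  define c :: real where "c = - 1 / (96 * pi ^ 2)"
  have "ext_deriv 3 E13 x v = c * (
       (?T (X 0 ** X 1) (X 2) (X 3) + ?T (X 1) (X 0 ** X 2) (X 3) + ?T (X 1) (X 2) (X 0 ** X 3))
     - (?T (X 1 ** X 0) (X 2) (X 3) + ?T (X 0) (X 1 ** X 2) (X 3) + ?T (X 0) (X 2) (X 1 ** X 3))
     + (?T (X 2 ** X 0) (X 1) (X 3) + ?T (X 0) (X 2 ** X 1) (X 3) + ?T (X 0) (X 1) (X 2 ** X 3))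
     - (?T (X 3 ** X 0) (X 1) (X 2) + ?T (X 0) (X 3 ** X 1) (X 2) + ?T (X 0) (X 1) (X 3 ** X 2)))"
    unfolding ext_deriv_def S frechet_derivative_eq[OF has_derivative_E13[OF det]] X_def
      c_def[symmetric]
    by (simp add: algebra_simps numeral_2_eq_2 numeral_3_eq_3)
  \<comment> \<open>Antisymmetry moves each of the twelve products to the first slot; there
    \<open>X i ** X j\<close> and \<open>X j ** X i\<close> pair up with opposite signs into six
    brackets.\<close>
  also have "\<dots> = c * (
       ?T (bracket (X 0) (X 1)) (X 2) (X 3) - ?T (bracket (X 0) (X 2)) (X 1) (X 3) + ?T (bracket (X 0) (X 3)) (X 1) (X 2)
       + ?T (bracket (X 1) (X 2)) (X 0) (X 3) - ?T (bracket (X 1) (X 3)) (X 0) (X 2) + ?T (bracket (X 2) (X 3)) (X 0) (X 1))"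
  proof -
    have "?T X (Y ** Z) W = - ?T (Y ** Z) X W" "?T X W (Y ** Z) = ?T (Y ** Z) X W" for X Y Z W :: mat4
      using pf_triple_swap(1)[of X "Y ** Z" W] pf_triple_swap(2)[of X W "Y ** Z"] by simp_all
    then show ?thesis
      unfolding bracket_def pf_triple_diff by (simp add: algebra_simps)
  qed
  \<comment> \<open>On skew-symmetric matrices each term is 3 times a \<open>pf_form\<close> of two
    brackets. By symmetry the six terms are two copies of the sum in
    \<open>pf_form_bracket_bracket\<close>.\<close>
  also have "\<dots> = 0"
    using pf_form_bracket_bracket[OF sk sk sk sk, of 0 1 2 3]
      pf_form_commute[of "bracket (X 1) (X 2)"] pf_form_commute[of "bracket (X 1) (X 3)"] pf_form_commute[of "bracket (X 2) (X 3)"]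
    by (simp add: pf_triple_skew skew_bracket sk)
  finally show "d_ver 1 3 E13 x v = 0" by (simp add: d_ver_def)
qed

section \<open>Pullback of Maurer-Cartan forms along the face maps\<close>

definition dface :: "nat \<Rightarrow> nat \<Rightarrow> mat4 bseq \<Rightarrow> mat4 bseq \<Rightarrow> mat4 bseq" where
  "dface q i h u = fin_seq {1..q - 1}
     (\<lambda>j. if j < i then u j else if j = i then h j ** u (Suc j) + u j ** h (Suc j) else u (Suc j))"

lemma has_derivative_face: "(face q i has_derivative dface q i h) (at h)"
  unfolding face_def[abs_def] dface_def[abs_def]
proof (rule has_derivative_fin_seq)
  fix j assume "j \<in> {1..q - 1}"
  show "((\<lambda>h::mat4 bseq. if j < i then h j else if j = i then h j ** h (Suc j) else h (Suc j)) has_derivative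
        (\<lambda>u::mat4 bseq. if j < i then u j else if j = i then h j ** u (Suc j) + u j ** h (Suc j) else u (Suc j))) (at h)"
    using mm.FDERIV[OF has_derivative_apply_bcontfun[OF has_derivative_ident] has_derivative_apply_bcontfun[OF has_derivative_ident],
        of j "Suc j" h UNIV]
    by (cases "j < i"; cases "j = i") (auto intro!: has_derivative_apply_bcontfun[OF has_derivative_ident])
qed simp

lemma pullback_face: "pullback (face q i) \<omega> x v = \<omega> (face q i x) (\<lambda>k. dface q i x (v k))"
  by (simp add: pullback_def frechet_derivative_eq[OF has_derivative_face])

lemma matrix_inv_SO4_mult:
  assumes "g \<in> SO4" "h \<in> SO4"
  shows "matrix_inv (g ** h) = transpose h ** transpose g"
  using SO4_D(4)[OF SO4_mult[OF assms]] by (simp add: matrix_transpose_mul)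

text \<open>At the merged entry this is
  \<open>(gh)^-1 d(gh) = h^-1 (g^-1 dg + dh h^-1) h\<close>.\<close>

lemma lmc_face:
  assumes x: "x \<in> NG q" and j: "j \<in> {1..q - 1}"
  shows "lmc j (face q i x) (dface q i x u) = (if j < i then lmc j x u
     else if j = i then conj_by (transpose (x (Suc j))) (lmc j x u + rmc (Suc j) x u) else lmc (Suc j) x u)"
proof -
  have g: "x j \<in> SO4" "x (Suc j) \<in> SO4" using NG_SO4[OF x] j by auto
  have "transpose h ** transpose g ** (g ** b + a ** h) = transpose h ** (transpose g ** a + b ** transpose h) ** h"
    if "g \<in> SO4" "h \<in> SO4" for g h a b :: mat4
  proof -
    have "transpose h ** transpose g ** (g ** b + a ** h)
      = transpose h ** (transpose g ** g) ** b + transpose h ** transpose g ** a ** h"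
      by (simp add: mm.add_right matrix_mul_assoc)
    moreover have "transpose h ** (transpose g ** a + b ** transpose h) ** h
      = transpose h ** transpose g ** a ** h + transpose h ** b ** (transpose h ** h)"
      by (simp add: mm.add_right mm.add_left matrix_mul_assoc)
    ultimately show ?thesis using SO4_D[OF that(1)] SO4_D[OF that(2)] by simp
  qed
  then show ?thesis
    using j g by (auto simp: lmc_def rmc_def face_def dface_def apply_fin_seq conj_by_def matrix_inv_SO4_mult SO4_D(4))
qed

text \<open>At the merged entry this is
  \<open>d(gh) (gh)^-1 = dg g^-1 + g (dh h^-1) g^-1\<close>.\<close>

lemma rmc_face:
  assumes x: "x \<in> NG q" and j: "j \<in> {1..q - 1}"
  shows "rmc j (face q i x) (dface q i x u) = (if j < i then rmc j x u
     else if j = i then rmc j x u + conj_by (x j) (rmc (Suc j) x u) else rmc (Suc j) x u)"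
proof -
  have g: "x j \<in> SO4" "x (Suc j) \<in> SO4" using NG_SO4[OF x] j by auto
  have "(g ** b + a ** h) ** (transpose h ** transpose g) = a ** transpose g + g ** (b ** transpose h) ** transpose g"
    if "g \<in> SO4" "h \<in> SO4" for g h a b :: mat4
  proof -
    have "(g ** b + a ** h) ** (transpose h ** transpose g)
      = g ** (b ** transpose h) ** transpose g + a ** (h ** transpose h) ** transpose g"
      by (simp add: mm.add_left matrix_mul_assoc)
    then show ?thesis using SO4_D[OF that(2)] by simp
  qed
  then show ?thesis
    using j g by (auto simp: rmc_def face_def dface_def apply_fin_seq conj_by_def matrix_inv_SO4_mult SO4_D(4))
qed

text \<open>With \<open>A = h_1^-1 dh_1\<close> and \<open>B = dh_2 h_2^-1\<close>, the three faces
  pull the left Maurer-Cartan form back to \<open>B\<close>, \<open>A + B\<close> and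
  \<open>A\<close>, the first two up to conjugation by \<open>h_2^-1\<close>. So
  \<open>d' E13\<close> is minus the mixed part of \<open>pf_triple\<close> on \<open>A + B\<close>,
  and invariance identifies \<open>d'' E22\<close> with that mixed part.\<close>

lemma d_hor_E13_d_ver_E22:
  "form_eq (NG 2) (\<lambda>x v. d_hor 1 E13 x v + d_ver 2 2 E22 x v) (\<lambda>x v. 0)"
  unfolding form_eq_def
proof (intro ballI allI impI)
  fix x :: "mat4 bseq" and v :: "nat \<Rightarrow> mat4 bseq" assume x: "x \<in> NG 2" and v: "\<forall>i. v i \<in> tangent_space (NG 2) x"
  define A where "A i = lmc 1 x (v i)" for i :: nat
  define B where "B i = rmc 2 x (v i)" for i :: nat
  have sk: "transpose (A i) = - A i" "transpose (B i) = - B i" for i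
    unfolding A_def B_def using skew_lmc[OF x] skew_rmc[OF x] v by simp_all
  have g: "x 1 \<in> SO4" "x 2 \<in> SO4" using NG_SO4[OF x] by auto
  then have det: "det (apply_bcontfun x 1) \<noteq> 0" "det (apply_bcontfun x 2) \<noteq> 0" using SO4_D by auto
  let ?T = pf_triple
  let ?h = "transpose (x 2)"
  have h: "?h \<in> SO4" using g SO4_transpose by simp
  have f0: "lmc 1 (face 2 0 x) (dface 2 0 x u) = conj_by ?h (rmc 2 x u)" for u
    using lmc_face[OF x, of 1 0 u] lmc_eq_conj_by[OF g(2), of u] by (simp add: numeral_2_eq_2)
  have f1: "lmc 1 (face 2 1 x) (dface 2 1 x u) = conj_by ?h (lmc 1 x u + rmc 2 x u)" for u
    using lmc_face[OF x, of 1 1 u] by (simp add: numeral_2_eq_2)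
  have f2: "lmc 1 (face 2 2 x) (dface 2 2 x u) = lmc 1 x u" for u
    using lmc_face[OF x, of 1 2 u] by simp
  have S: "(\<Sum>i = 0..1 + 1. f i) = f 0 + f 1 + f 2" for f :: "nat \<Rightarrow> real"
    by (simp add: numeral_2_eq_2)
  have hor: "d_hor 1 E13 x v = 1 / (96 * pi ^ 2) *
      (?T (B 0) (B 1) (B 2) - ?T (A 0 + B 0) (A 1 + B 1) (A 2 + B 2) + ?T (A 0) (A 1) (A 2))"
    unfolding d_hor_def S unfolding one_add_one pullback_face E13_triple f0 f1 f2 pf_triple_conj_by[OF h] A_def B_def
    by (simp add: field_simps)
  have S2: "(\<Sum>i\<le>2. f i) = f 0 + f 1 + f 2" for f :: "nat \<Rightarrow> real"
    by (simp add: numeral_2_eq_2)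
  define c :: real where "c = 1 / (32 * pi ^ 2)"
  have "d_ver 2 2 E22 x v = c * (
       (pf_form (A 0 ** A 1) (B 2) + pf_form (A 1) (B 2 ** B 0) - pf_form (A 0 ** A 2) (B 1) - pf_form (A 2) (B 1 ** B 0))
     - (pf_form (A 1 ** A 0) (B 2) + pf_form (A 0) (B 2 ** B 1) - pf_form (A 1 ** A 2) (B 0) - pf_form (A 2) (B 0 ** B 1))
     + (pf_form (A 2 ** A 0) (B 1) + pf_form (A 0) (B 1 ** B 2) - pf_form (A 2 ** A 1) (B 0) - pf_form (A 1) (B 0 ** B 2)))"
    unfolding d_ver_def ext_deriv_def S2 frechet_derivative_eq[OF has_derivative_E22[OF det]] A_def B_def
      c_def[symmetric]
    by (simp add: algebra_simps numeral_2_eq_2)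
  also have "\<dots> = c * (
       pf_form (bracket (A 0) (A 1)) (B 2) - pf_form (bracket (A 0) (A 2)) (B 1) + pf_form (bracket (A 1) (A 2)) (B 0)
     + pf_form (A 0) (bracket (B 1) (B 2)) - pf_form (A 1) (bracket (B 0) (B 2)) + pf_form (A 2) (bracket (B 0) (B 1)))"
    unfolding bracket_def pf.diff_left pf.diff_right by (simp add: algebra_simps)
  also have "\<dots> = 1 / (96 * pi ^ 2) *
      (?T (A 0 + B 0) (A 1 + B 1) (A 2 + B 2) - ?T (B 0) (B 1) (B 2) - ?T (A 0) (A 1) (A 2))"
  proof -
    note r = pf_form_bracket_rotate[of "A _" "A _" "B _", OF sk(1) sk(1) sk(2)]
      pf_form_bracket_rotate[of "B _" "B _" "A _", OF sk(2) sk(2) sk(1)]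
    have "?T (A 0 + B 0) (A 1 + B 1) (A 2 + B 2) - ?T (B 0) (B 1) (B 2) - ?T (A 0) (A 1) (A 2) = 3 *
       (pf_form (A 0) (bracket (A 1) (B 2)) + pf_form (A 0) (bracket (B 1) (A 2)) + pf_form (B 0) (bracket (A 1) (A 2))
       + pf_form (B 0) (bracket (B 1) (A 2)) + pf_form (B 0) (bracket (A 1) (B 2)) + pf_form (A 0) (bracket (B 1) (B 2)))"
      by (simp add: pf_triple_skew skew_add sk pf.add_left pf.add_right br.add_left br.add_right algebra_simps)
    also have "pf_form (A 0) (bracket (A 1) (B 2)) = pf_form (bracket (A 0) (A 1)) (B 2)"
      using pf_form_bracket[OF sk(1) sk(1) sk(2), of 0 1 2] by simp
    also have "pf_form (A 0) (bracket (B 1) (A 2)) = - pf_form (bracket (A 0) (A 2)) (B 1)"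
      using pf_form_bracket[OF sk(1) sk(1) sk(2), of 0 2 1] bracket_swap[of "A 2" "B 1"] by (simp add: pf.minus_right)
    also have "pf_form (B 0) (bracket (A 1) (A 2)) = pf_form (bracket (A 1) (A 2)) (B 0)"
      by (rule pf_form_commute)
    also have "pf_form (B 0) (bracket (B 1) (A 2)) = pf_form (A 2) (bracket (B 0) (B 1))"
      using pf_form_bracket[OF sk(2) sk(2) sk(1), of 0 1 2] pf_form_commute[of "A 2"] by simp
    also have "pf_form (B 0) (bracket (A 1) (B 2)) = - pf_form (A 1) (bracket (B 0) (B 2))"
      using pf_form_bracket[OF sk(2) sk(2) sk(1), of 0 2 1] pf_form_commute[of "A 1"] bracket_swap[of "B 2" "A 1"]
      by (simp add: pf.minus_right)
    finally have e: "?T (A 0 + B 0) (A 1 + B 1) (A 2 + B 2) - ?T (B 0) (B 1) (B 2) - ?T (A 0) (A 1) (A 2) = 3 *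
       (pf_form (bracket (A 0) (A 1)) (B 2) - pf_form (bracket (A 0) (A 2)) (B 1) + pf_form (bracket (A 1) (A 2)) (B 0)
     + pf_form (A 0) (bracket (B 1) (B 2)) - pf_form (A 1) (bracket (B 0) (B 2)) + pf_form (A 2) (bracket (B 0) (B 1)))"
      by simp
    \<comment> \<open>The factor 3 from \<open>pf_triple_skew\<close> is what matches the constants
      of \<open>E13\<close> and \<open>E22\<close>.\<close>
    have "c = 3 * (1 / (96 * pi ^ 2))" by (simp add: c_def)
    then show ?thesis unfolding e by (simp only: mult_ac)
  qed
  finally show "d_hor 1 E13 x v + d_ver 2 2 E22 x v = 0"
    unfolding hor by (simp add: field_simps)
qed

text \<open>Let \<open>a\<close>, \<open>b\<close> be \<open>lmc 1\<close>, \<open>rmc 2\<close>,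
  and \<open>c\<close> the conjugate of \<open>rmc 3\<close> by \<open>x 2\<close>. The faces give
  the pairings \<open>(b, c)\<close>, \<open>(a + b, c)\<close>, \<open>(a, b + c)\<close> and
  \<open>(a, b)\<close>, whose alternating sum vanishes by bilinearity.\<close>

lemma d_hor_E22: "form_eq (NG 3) (d_hor 2 E22) (\<lambda>x v. 0)"
  unfolding form_eq_def
proof (intro ballI allI impI)
  fix x :: "mat4 bseq" and v :: "nat \<Rightarrow> mat4 bseq" assume x: "x \<in> NG 3"
  have g: "x 2 \<in> SO4" using NG_SO4[OF x] by auto
  let ?h = "transpose (x 2)"
  have l: "lmc 1 (face 3 0 x) (dface 3 0 x u) = conj_by ?h (rmc 2 x u)"
    "lmc 1 (face 3 1 x) (dface 3 1 x u) = conj_by ?h (lmc 1 x u + rmc 2 x u)"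
    "lmc 1 (face 3 2 x) (dface 3 2 x u) = lmc 1 x u"
    "lmc 1 (face 3 3 x) (dface 3 3 x u) = lmc 1 x u" for u
    using lmc_face[OF x, of 1 _ u] lmc_eq_conj_by[OF g, of u] by (simp_all add: numeral_2_eq_2)
  have r: "rmc 2 (face 3 0 x) (dface 3 0 x u) = rmc 3 x u"
    "rmc 2 (face 3 1 x) (dface 3 1 x u) = rmc 3 x u"
    "rmc 2 (face 3 2 x) (dface 3 2 x u) = rmc 2 x u + conj_by (x 2) (rmc 3 x u)"
    "rmc 2 (face 3 3 x) (dface 3 3 x u) = rmc 2 x u" for u
    using rmc_face[OF x, of 2 _ u] by simp_all
  have c: "pf_form (conj_by ?h X) Y = pf_form X (conj_by (x 2) Y)" for X Y
    using pf_form_conj_by[OF g, of "conj_by ?h X" Y] by (simp add: conj_by_transpose_cancel[OF g])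
  have S: "(\<Sum>i = 0..2 + 1. f i) = f 0 + f 1 + f 2 + f 3" for f :: "nat \<Rightarrow> real"
    by (simp add: numeral_2_eq_2 numeral_3_eq_3)
  have q: "2 + 1 = (3::nat)" by simp
  show "d_hor 2 E22 x v = 0"
    unfolding d_hor_def S unfolding q pullback_face E22_eq l r c
    by (simp add: conj_by_add pf.add_left pf.add_right algebra_simps)
qed

section \<open>Assembling the components into a cocycle\<close>

lemma d_hor_zero: "d_hor r (\<lambda>x v. 0) = (\<lambda>x v. 0)"
  by (simp add: d_hor_def pullback_def)

lemma ext_deriv_zero: "ext_deriv k (\<lambda>x v. 0) = (\<lambda>x v. 0)"
  by (simp add: ext_deriv_def frechet_derivative_const)

lemma d_ver_zero: "d_ver r s (\<lambda>x v. 0) = (\<lambda>x v. 0)"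
  by (simp add: d_ver_def ext_deriv_zero)

lemma smooth_form_zero: "smooth_form k M (\<lambda>x v. 0)"
  unfolding smooth_form_def
  by (intro exI[of _ UNIV]) (auto simp: alternating_form_def Ck_on_const bounded_linear_zero)

lemma is_cochain_zero: "is_cochain n (\<lambda>r x v. 0)"
  by (simp add: is_cochain_def smooth_form_zero)

lemma is_cocycle_E_cochain: "is_cocycle 4 E_cochain"
  unfolding is_cocycle_def
proof
  show "is_cochain 4 E_cochain"
    using smooth_form_E13 smooth_form_E22 by (auto simp: is_cochain_def E_cochain_def smooth_form_zero)
  show "cochain_eq (4 + 1) (d_tot 4 E_cochain) (\<lambda>r x v. 0)"
    unfolding cochain_eq_def
  proof (intro allI impI)
    fix r :: nat assume "r \<le> 4 + 1"
    then consider "r = 0" | "r = 1" | "r = 2" | "r = 3" | "r = 4" | "r = 5" by linarith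
    then show "form_eq (NG r) (d_tot 4 E_cochain r) (\<lambda>x v. 0)"
    proof cases
      case 2
      then show ?thesis using d_ver_E13 by (simp add: d_tot_def E_cochain_def d_hor_zero)
    next
      case 3
      then show ?thesis using d_hor_E13_d_ver_E22 by (simp add: d_tot_def E_cochain_def)
    next
      case 4
      then show ?thesis using d_hor_E22 by (simp add: d_tot_def E_cochain_def d_ver_zero)
    qed (simp_all add: d_tot_def E_cochain_def d_hor_zero d_ver_zero form_eq_def)
  qed
qed

section \<open>The Euler class\<close>

text \<open>
  The value on a pair of vectors of the curvature of \<open>\<Sum>\<^sub>i t\<^sub>i \<theta>\<^sub>i\<close>, where \<open>d\<theta>\<^sub>i = -\<theta>\<^sub>i \<and> \<theta>\<^sub>i\<close>; the first vector has
  components \<open>dt\<^sub>i = \<tau> i\<close>, \<open>\<theta>\<^sub>i = X i\<close>, the second one \<open>dt\<^sub>i = \<sigma> i\<close>, \<open>\<theta>\<^sub>i = Y i\<close>.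
\<close>

definition conn_curv ::
    "nat \<Rightarrow> (nat \<Rightarrow> real) \<Rightarrow> (nat \<Rightarrow> real) \<Rightarrow> (nat \<Rightarrow> real) \<Rightarrow> (nat \<Rightarrow> mat4) \<Rightarrow> (nat \<Rightarrow> mat4) \<Rightarrow> mat4" where
  "conn_curv r t \<tau> \<sigma> X Y =
     (\<Sum>i=0..r. \<tau> i *\<^sub>R Y i) - (\<Sum>i=0..r. \<sigma> i *\<^sub>R X i) - (\<Sum>i=0..r. t i *\<^sub>R bracket (X i) (Y i))
     + bracket (\<Sum>i=0..r. t i *\<^sub>R X i) (\<Sum>i=0..r. t i *\<^sub>R Y i)"

text \<open>A common shift of all \<open>\<theta>\<^sub>i\<close> appears when the gauge changes from \<open>1\<close> to \<open>g\<^sub>0\<close>.\<close>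

lemma conn_curv_shift:
  assumes "(\<Sum>i=0..r. t i) = 1" "(\<Sum>i=0..r. \<tau> i) = 0" "(\<Sum>i=0..r. \<sigma> i) = 0"
  shows "conn_curv r t \<tau> \<sigma> (\<lambda>i. X i - C) (\<lambda>i. Y i - D) = conn_curv r t \<tau> \<sigma> X Y"
proof -
  have lin: "(\<Sum>i=0..r. c i *\<^sub>R (Z i - K)) = (\<Sum>i=0..r. c i *\<^sub>R Z i) - (\<Sum>i=0..r. c i) *\<^sub>R K" for c and Z :: "nat \<Rightarrow> mat4" and K
    by (simp add: scaleR_diff_right sum_subtractf scaleR_sum_left)
  \<comment> \<open>Once the \<open>t i\<close> sum to 1, the terms in \<open>C\<close> and
    \<open>D\<close> here are the same as those from the bracket of the two averages, and they enter
    the curvature with opposite signs.\<close>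
  have "(\<Sum>i=0..r. t i *\<^sub>R bracket (X i - C) (Y i - D)) =
      (\<Sum>i=0..r. t i *\<^sub>R bracket (X i) (Y i)) - bracket (\<Sum>i=0..r. t i *\<^sub>R X i) D
      - bracket C (\<Sum>i=0..r. t i *\<^sub>R Y i) + (\<Sum>i=0..r. t i) *\<^sub>R bracket C D"
    by (simp add: br.diff_left br.diff_right br.sum_left br.sum_right br.scaleR_left br.scaleR_right
        scaleR_diff_right sum_subtractf scaleR_sum_left)
  then show ?thesis
    unfolding conn_curv_def lin assms by (simp add: assms br.diff_left br.diff_right)
qed

lemma conn_curv_conj_by:
  assumes "g \<in> SO4"
  shows "conn_curv r t \<tau> \<sigma> (\<lambda>i. conj_by g (X i)) (\<lambda>i. conj_by g (Y i)) = conj_by g (conn_curv r t \<tau> \<sigma> X Y)"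
  by (simp only: conn_curv_def conj_by_scaleR[symmetric] conj_by_sum[symmetric] bracket_conj_by[OF assms]
      conj_by_diff[symmetric] conj_by_add[symmetric])

lemma conn_curv_swap: "conn_curv r t \<sigma> \<tau> Y X = - conn_curv r t \<tau> \<sigma> X Y"
proof -
  have "(\<Sum>i=0..r. t i *\<^sub>R bracket (Y i) (X i)) = - (\<Sum>i=0..r. t i *\<^sub>R bracket (X i) (Y i))"
    by (subst bracket_swap) (simp add: sum_negf)
  moreover have "bracket (\<Sum>i=0..r. t i *\<^sub>R Y i) (\<Sum>i=0..r. t i *\<^sub>R X i)
      = - bracket (\<Sum>i=0..r. t i *\<^sub>R X i) (\<Sum>i=0..r. t i *\<^sub>R Y i)"
    by (rule bracket_swap)
  ultimately show ?thesis by (simp add: conn_curv_def)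
qed

lemma conn_curv_cong:
  assumes "\<And>i. i \<le> r \<Longrightarrow> X i = X' i" "\<And>i. i \<le> r \<Longrightarrow> Y i = Y' i"
  shows "conn_curv r t \<tau> \<sigma> X Y = conn_curv r t \<tau> \<sigma> X' Y'"
  using assms by (simp add: conn_curv_def)

section \<open>The curvature on the total space\<close>

lemma theta_eq: "theta r x w = (\<Sum>i=0..r. apply_bcontfun (fst x) i *\<^sub>R lmc i (snd x) (snd (w 0)))"
  by (simp add: theta_def lmc_def)

lemma has_derivative_theta:
  fixes x :: "real bseq \<times> mat4 bseq"
  assumes "\<And>i. i \<le> r \<Longrightarrow> det (apply_bcontfun (snd x) i) \<noteq> 0"
  shows "((\<lambda>y. theta r y w) has_derivative (\<lambda>u. \<Sum>i=0..r.
     apply_bcontfun (fst x) i *\<^sub>R (- (lmc i (snd x) (snd u) ** lmc i (snd x) (snd (w 0)))) + apply_bcontfun (fst u) i *\<^sub>R lmc i (snd x) (snd (w 0)))) (at x)"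
  unfolding theta_eq
proof (rule has_derivative_sum)
  fix i assume i: "i \<in> {0..r}"
  have 1: "((\<lambda>y :: real bseq \<times> mat4 bseq. apply_bcontfun (fst y) i) has_derivative (\<lambda>u. apply_bcontfun (fst u) i)) (at x)"
    by (intro has_derivative_apply_bcontfun has_derivative_fst has_derivative_ident)
  have 2: "((\<lambda>y :: real bseq \<times> mat4 bseq. lmc i (snd y) (snd (w 0))) has_derivative
      (\<lambda>u. - (lmc i (snd x) (snd u) ** lmc i (snd x) (snd (w 0))))) (at x)"
    using diff_chain_at[OF has_derivative_snd[OF has_derivative_ident] has_derivative_lmc[of "snd x" i "snd (w 0)"]]
      assms[of i] i by (simp add: o_def)
  show "((\<lambda>y :: real bseq \<times> mat4 bseq. apply_bcontfun (fst y) i *\<^sub>R lmc i (snd y) (snd (w 0))) has_derivative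
      (\<lambda>u. apply_bcontfun (fst x) i *\<^sub>R (- (lmc i (snd x) (snd u) ** lmc i (snd x) (snd (w 0)))) + apply_bcontfun (fst u) i *\<^sub>R lmc i (snd x) (snd (w 0)))) (at x)"
    by (rule bounded_bilinear.FDERIV[OF bounded_bilinear_scaleR 1 2])
qed

text \<open>Differentiating \<open>t_i\<close> gives \<open>dt_i \<and> \<theta>_i\<close>,
  differentiating \<open>\<theta>_i\<close> gives \<open>- t_i \<theta>_i \<and> \<theta>_i\<close>,
  and the square of \<open>\<theta>\<close> adds the last bracket.\<close>

lemma curvature_eq:
  fixes x :: "real bseq \<times> mat4 bseq"
  assumes "\<And>i. i \<le> r \<Longrightarrow> det (apply_bcontfun (snd x) i) \<noteq> 0"
  shows "curvature r x w = conn_curv r (apply_bcontfun (fst x)) (apply_bcontfun (fst (w 0))) (apply_bcontfun (fst (w 1)))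
    (\<lambda>i. lmc i (snd x) (snd (w 0))) (\<lambda>i. lmc i (snd x) (snd (w 1)))"
proof -
  have "mat_wedge 1 1 (theta r) (theta r) x w =
      bracket (\<Sum>i=0..r. apply_bcontfun (fst x) i *\<^sub>R lmc i (snd x) (snd (w 0))) (\<Sum>i=0..r. apply_bcontfun (fst x) i *\<^sub>R lmc i (snd x) (snd (w 1)))"
    unfolding bracket_def
    by (rule mat_wedge_1_1[where a="\<lambda>u. \<Sum>i=0..r. apply_bcontfun (fst x) i *\<^sub>R lmc i (snd x) (snd u)"
          and b="\<lambda>u. \<Sum>i=0..r. apply_bcontfun (fst x) i *\<^sub>R lmc i (snd x) (snd u)"]) (rule theta_eq)+
  moreover have "ext_deriv 1 (theta r) x w =
      (\<Sum>i=0..r. apply_bcontfun (fst x) i *\<^sub>R (- (lmc i (snd x) (snd (w 0)) ** lmc i (snd x) (snd (w 1)))) + apply_bcontfun (fst (w 0)) i *\<^sub>R lmc i (snd x) (snd (w 1)))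
    - (\<Sum>i=0..r. apply_bcontfun (fst x) i *\<^sub>R (- (lmc i (snd x) (snd (w 1)) ** lmc i (snd x) (snd (w 0)))) + apply_bcontfun (fst (w 1)) i *\<^sub>R lmc i (snd x) (snd (w 0)))"
    unfolding ext_deriv_def by (simp add: frechet_derivative_eq[OF has_derivative_theta[OF assms]])
  ultimately show ?thesis
    by (simp add: curvature_def conn_curv_def bracket_def sum.distrib sum_subtractf sum_negf scaleR_diff_right)
qed

section \<open>The curvature on the base, in the gauge \<open>g_0\<close>\<close>

primrec face_prod :: "mat4 bseq \<Rightarrow> nat \<Rightarrow> mat4" where
  "face_prod h 0 = mat 1"
| "face_prod h (Suc i) = face_prod h i ** h (Suc i)"

text \<open>
  \<open>section_mc h u i\<close> is the value on \<open>u\<close> of \<open>k\<^sub>i\<^sup>-\<^sup>1 dk\<^sub>i\<close> for \<open>k\<^sub>i = (h\<^sub>1 \<cdots> h\<^sub>i)\<^sup>-\<^sup>1\<close>. Transposes in place of inverses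
  make it polynomial in \<open>h\<close>, hence smooth on the whole ambient space.
\<close>

primrec section_mc :: "mat4 bseq \<Rightarrow> mat4 bseq \<Rightarrow> nat \<Rightarrow> mat4" where
  "section_mc h u 0 = 0"
| "section_mc h u (Suc i) = section_mc h u i - conj_by (face_prod h i) (u (Suc i) ** transpose (h (Suc i)))"

definition base_curv :: "nat \<Rightarrow> (real bseq \<times> mat4 bseq, mat4) form" where
  "base_curv r = (\<lambda>x w. conn_curv r (apply_bcontfun (fst x)) (apply_bcontfun (fst (w 0))) (apply_bcontfun (fst (w 1)))
     (section_mc (snd x) (snd (w 0))) (section_mc (snd x) (snd (w 1))))"

text \<open>The constant 128 is \<open>2 ^ 4 * fact 2\<close> from \<open>Pf\<close> times
  \<open>fact 2 * fact 2\<close> from \<open>wedge 2 2\<close>.\<close>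

lemma Pf_alt_sum:
  assumes "\<And>w. A x w = a (w 0) (w 1)"
  shows "Pf A x v = 1 / (128 * pi ^ 2) * alt_sum 4 (\<lambda>w. pf_form (a (w 0) (w 1)) (a (w 2) (w 3))) v"
proof -
  have "2 + 0 = (2::nat)" "2 + 1 = (3::nat)" "2 + 2 = (4::nat)" by simp_all
  then show ?thesis
    unfolding Pf_def pf_form_wedge assms by (simp add: fact_numeral)
qed

text \<open>The 24 terms fall into the three pairings of four slots, eight to each: four orders
  inside the pairs, and two orders of the pairs by symmetry of \<open>pf_form\<close>. Hence 8/128 =
  1/16.\<close>

lemma Pf_eq:
  assumes "\<And>w. A x w = a (w 0) (w 1)" "\<And>u w. a w u = - a u w"
  shows "Pf A x v = 1 / (16 * pi ^ 2) * (pf_form (a (v 0) (v 1)) (a (v 2) (v 3))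
    - pf_form (a (v 0) (v 2)) (a (v 1) (v 3)) + pf_form (a (v 0) (v 3)) (a (v 1) (v 2)))"
proof -
  note sw = assms(2)[of "v 1" "v 0"] assms(2)[of "v 2" "v 0"] assms(2)[of "v 3" "v 0"]
    assms(2)[of "v 2" "v 1"] assms(2)[of "v 3" "v 1"] assms(2)[of "v 3" "v 2"]
  have "alt_sum 4 (\<lambda>w. pf_form (a (w 0) (w 1)) (a (w 2) (w 3))) v = 8 * (pf_form (a (v 0) (v 1)) (a (v 2) (v 3))
    - pf_form (a (v 0) (v 2)) (a (v 1) (v 3)) + pf_form (a (v 0) (v 3)) (a (v 1) (v 2)))"
    unfolding alt_sum_4[of "\<lambda>b c d e. pf_form (a b c) (a d e)"]
    by (simp add: sw pf.minus_left pf.minus_right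
        pf_form_commute[of "a (v 2) (v 3)"] pf_form_commute[of "a (v 1) (v 3)"]
        pf_form_commute[of "a (v 1) (v 2)"] del: One_nat_def)
  moreover have "1 / (128 * pi ^ 2) * (8 * K) = 1 / (16 * pi ^ 2) * K" for K :: real by simp
  ultimately show ?thesis unfolding Pf_alt_sum[where A=A and x=x and a=a, OF assms(1)] by (simp only:)
qed

lemma bounded_linear_section_mc: "bounded_linear (\<lambda>u. section_mc h u i)"
proof (induction i)
  case (Suc i)
  show ?case
    by (simp, intro bounded_linear_sub Suc bounded_linear_compose[OF bounded_linear_conj_by]
        bounded_linear_compose[OF mm.bounded_linear_left] bounded_linear_apply_bcontfun)
qed (simp add: bounded_linear_zero)

lemma section_mc_zero: "section_mc h 0 i = 0"
  using linear_0[OF bounded_linear.linear[OF bounded_linear_section_mc]] .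

lemma bounded_linear_base_curv:
  fixes w :: "real bseq \<times> mat4 bseq"
  shows "bounded_linear (\<lambda>u :: real bseq \<times> mat4 bseq.
    conn_curv r t (apply_bcontfun (fst u)) (apply_bcontfun (fst w)) (section_mc h (snd u)) (section_mc h (snd w)))"
proof -
  have f: "bounded_linear (\<lambda>u :: real bseq \<times> mat4 bseq. apply_bcontfun (fst u) i)" for i
    by (rule bounded_linear_compose[OF bounded_linear_apply_bcontfun bounded_linear_fst])
  have s: "bounded_linear (\<lambda>u :: real bseq \<times> mat4 bseq. section_mc h (snd u) i)" for i
    by (rule bounded_linear_compose[OF bounded_linear_section_mc bounded_linear_snd])
  show ?thesis
    unfolding conn_curv_def
    by (intro bounded_linear_add bounded_linear_sub bounded_linear_sum
        bounded_linear_compose[OF bounded_linear_scaleR_left f] bounded_linear_compose[OF bounded_linear_scaleR_right]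
        bounded_linear_compose[OF br.bounded_linear_left] s)
qed

lemma Ck_on_conn_curv:
  assumes "open U" "\<And>i. Ck_on n (\<lambda>x. t x i) U" "\<And>i. Ck_on n (\<lambda>x. X x i) U" "\<And>i. Ck_on n (\<lambda>x. Y x i) U"
  shows "Ck_on n (\<lambda>x. conn_curv r (t x) \<tau> \<sigma> (X x) (Y x)) U"
  unfolding conn_curv_def
  by (intro Ck_on_add Ck_on_diff Ck_on_sum assms Ck_on_linear[OF assms(1) bounded_linear_scaleR_right]
      Ck_on_bilinear[OF assms(1) bounded_bilinear_bracket] Ck_on_bilinear[OF assms(1) bounded_bilinear_scaleR])

lemma Ck_on_face_prod: "Ck_on n (\<lambda>x :: real bseq \<times> mat4 bseq. face_prod (snd x) i) UNIV"
proof (induction i)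
  case (Suc i)
  show ?case
    by (simp, intro Ck_on_bilinear[OF _ bounded_bilinear_matrix_mult] Suc Ck_on_apply_bcontfun
        Ck_on_linear[OF _ bounded_linear_snd] Ck_on_ident open_UNIV)
qed (simp add: Ck_on_const)

lemma Ck_on_section_mc: "Ck_on n (\<lambda>x :: real bseq \<times> mat4 bseq. section_mc (snd x) u i) UNIV"
proof (induction i)
  case (Suc i)
  show ?case
    unfolding section_mc.simps conj_by_def
    by (intro Ck_on_diff Ck_on_bilinear[OF _ bounded_bilinear_matrix_mult] Suc Ck_on_apply_bcontfun Ck_on_const
        Ck_on_linear[OF _ bounded_linear_transpose]
        Ck_on_linear[OF _ bounded_linear_snd] Ck_on_ident Ck_on_face_prod open_UNIV)
qed (simp add: Ck_on_const)

lemma smooth_form_Pf_base_curv: "smooth_form 4 M (Pf (base_curv r))"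
  unfolding smooth_form_def
proof (intro exI conjI ballI allI)
  define a where "a x u w = conn_curv r (apply_bcontfun (fst x)) (apply_bcontfun (fst u)) (apply_bcontfun (fst w)) (section_mc (snd x) (snd u)) (section_mc (snd x) (snd w))"
    for x u w :: "real bseq \<times> mat4 bseq"
  have a: "base_curv r x w = a x (w 0) (w 1)" for x w by (simp add: base_curv_def a_def)
  show "open (UNIV :: (real bseq \<times> mat4 bseq) set)" "M \<subseteq> UNIV" by auto
  have l1: "bounded_linear (\<lambda>u. a x u w)" for x w
    unfolding a_def by (rule bounded_linear_base_curv)
  have l2: "bounded_linear (\<lambda>u. a x w u)" for x w
  proof -
    have "(\<lambda>u. a x w u) = (\<lambda>u. - a x u w)" unfolding a_def using conn_curv_swap by blast
    then show ?thesis using bounded_linear_minus[OF l1] by simp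
  qed
  show "alternating_form 4 (Pf (base_curv r) x)" for x
  proof -
    have "Pf (base_curv r) x = (\<lambda>v. 1 / (128 * pi ^ 2) * alt_sum 4 (\<lambda>w. pf_form (a x (w 0) (w 1)) (a x (w 2) (w 3))) v)"
      by (rule ext, rule Pf_alt_sum, rule a)
    moreover have "alternating_form 4 (\<lambda>v. 1 / (128 * pi ^ 2) * alt_sum 4 (\<lambda>w. pf_form (a x (w 0) (w 1)) (a x (w 2) (w 3))) v)"
    proof (rule alternating_form_alt_sum)
      fix v :: "nat \<Rightarrow> real bseq \<times> mat4 bseq" and i :: nat assume "i < 4"
      then consider "i = 0" | "i = 1" | "i = 2" | "i = 3" by linarith
      then show "bounded_linear (\<lambda>u. pf_form (a x ((v(i := u)) 0) ((v(i := u)) 1)) (a x ((v(i := u)) 2) ((v(i := u)) 3)))"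
        by cases (simp_all add: bounded_linear_compose[OF pf.bounded_linear_left] bounded_linear_compose[OF pf.bounded_linear_right] l1 l2)
    qed auto
    ultimately show ?thesis by simp
  qed
  show "Ck_on n (\<lambda>x. Pf (base_curv r) x v) UNIV" for v n
  proof -
    have "Pf (base_curv r) x v = 1 / (16 * pi ^ 2) * (pf_form (a x (v 0) (v 1)) (a x (v 2) (v 3))
      - pf_form (a x (v 0) (v 2)) (a x (v 1) (v 3)) + pf_form (a x (v 0) (v 3)) (a x (v 1) (v 2)))" for x
      by (rule Pf_eq[where A="base_curv r" and x=x and a="a x", OF a]) (unfold a_def, rule conn_curv_swap)
    moreover have ck: "Ck_on n (\<lambda>x. a x u w) UNIV" for u w
      unfolding a_def
      by (intro Ck_on_conn_curv Ck_on_section_mc Ck_on_apply_bcontfun Ck_on_linear[OF _ bounded_linear_fst]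
          Ck_on_ident open_UNIV)
    ultimately show ?thesis
      by (simp only:) (intro Ck_on_linear[OF _ bounded_linear_mult_right] Ck_on_add Ck_on_diff
          Ck_on_bilinear[OF _ bounded_bilinear_pf_form] ck open_UNIV)
  qed
qed

section \<open>Descent along \<open>gamma\<close>\<close>

definition dgamma :: "nat \<Rightarrow> mat4 bseq \<Rightarrow> mat4 bseq \<Rightarrow> mat4 bseq" where
  "dgamma r g w = fin_seq {1..r} (\<lambda>i. g (i - 1) ** (- (matrix_inv (g i) ** w i ** matrix_inv (g i))) + w (i - 1) ** matrix_inv (g i))"

lemma has_derivative_gamma:
  fixes g :: "mat4 bseq"
  assumes "\<And>i. i \<in> {1..r} \<Longrightarrow> det (g i) \<noteq> 0"
  shows "(gamma r has_derivative dgamma r g) (at g)"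
  unfolding gamma_def[abs_def] dgamma_def[abs_def]
  by (rule has_derivative_fin_seq)
    (auto intro!: mm.FDERIV has_derivative_matrix_inv has_derivative_apply_bcontfun[OF has_derivative_ident] assms)

lemma face_prod_gamma:
  assumes "g \<in> NbarG r" "i \<le> r"
  shows "face_prod (gamma r g) i = g 0 ** transpose (g i)"
  using assms(2)
proof (induction i)
  case 0
  then show ?case using assms(1) by (simp add: NbarG_def SO4_D)
next
  case (Suc i)
  then have s: "g i \<in> SO4" "g (Suc i) \<in> SO4" using assms(1) by (auto simp: NbarG_def)
  have "face_prod (gamma r g) (Suc i) = g 0 ** transpose (g i) ** (g i ** transpose (g (Suc i)))"
    using Suc by (simp add: gamma_def apply_fin_seq SO4_D(4)[OF s(2)])
  also have "\<dots> = g 0 ** (transpose (g i) ** g i) ** transpose (g (Suc i))"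
    by (simp only: matrix_mul_assoc)
  finally show ?case using SO4_D[OF s(1)] by simp
qed

text \<open>The change of gauge: at \<open>gamma r g\<close> the section has components
  \<open>k_i = g_i g_0^-1\<close>, and \<open>k_i^-1 dk_i\<close> is the conjugate of
  \<open>\<theta>_i - \<theta>_0\<close> by \<open>g_0\<close>.\<close>

lemma section_mc_gamma:
  assumes "g \<in> NbarG r" "i \<le> r"
  shows "section_mc (gamma r g) (dgamma r g w) i = conj_by (g 0) (lmc i g w - lmc 0 g w)"
  using assms(2)
proof (induction i)
  case 0
  then show ?case by (simp add: conj_by_zero)
next
  case (Suc i)
  let ?a = "g i" and ?b = "g (Suc i)" and ?i = "transpose (g i)" and ?j = "transpose (g (Suc i))"
  have s: "?a \<in> SO4" "?b \<in> SO4" using assms(1) Suc.prems by (auto simp: NbarG_def)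
  have "conj_by (g 0 ** ?i) ((?a ** (- (?j ** w (Suc i) ** ?j)) + w i ** ?j) ** transpose (?a ** ?j))
    = g 0 ** (?i ** w i) ** (?j ** ?b) ** (?i ** ?a) ** transpose (g 0)
      - g 0 ** (?i ** ?a) ** ?j ** w (Suc i) ** (?j ** ?b) ** (?i ** ?a) ** transpose (g 0)"
    by (simp add: conj_by_def matrix_transpose_mul mm.add_left mm.add_right mm.minus_left mm.minus_right
        mm.diff_left mm.diff_right matrix_mul_assoc)
  also have "\<dots> = conj_by (g 0) (lmc i g w - lmc (Suc i) g w)"
    using SO4_D[OF s(1)] SO4_D[OF s(2)]
    by (simp add: conj_by_def lmc_def mm.diff_left mm.diff_right matrix_mul_assoc)
  finally have "conj_by (face_prod (gamma r g) i) (dgamma r g w (Suc i) ** transpose (gamma r g (Suc i))) =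
      conj_by (g 0) (lmc i g w - lmc (Suc i) g w)"
    using Suc.prems face_prod_gamma[OF assms(1), of i] by (simp add: gamma_def dgamma_def apply_fin_seq SO4_D(4)[OF s(2)])
  then show ?case using Suc by (simp add: conj_by_diff)
qed

text \<open>Differentiates the equation that the \<open>t i\<close> sum to 1; this supplies the
  hypotheses of \<open>conn_curv_shift\<close>.\<close>

lemma tangent_Simplex:
  assumes "u \<in> tangent_space (Simplex r \<times> M) x"
  shows "(\<Sum>i=0..r. apply_bcontfun (fst u) i) = 0"
  by (rule tangent_space_const[OF _ _ assms, where f="\<lambda>y. \<Sum>i=0..r. apply_bcontfun (fst y) i" and c=1])
    (auto simp: Simplex_def intro!: has_derivative_sum has_derivative_apply_bcontfun has_derivative_fst has_derivative_ident)

text \<open>The two gauges differ by the common shift \<open>\<theta>_0\<close> and conjugation by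
  \<open>g_0\<close>. On tangent vectors the shift leaves the curvature unchanged, and
  \<open>pf_form\<close> is invariant under the conjugation.\<close>

lemma descended_Pf_base_curv: "descended_Pf r (Pf (base_curv r))"
  unfolding descended_Pf_def form_eq_def
proof (intro conjI ballI allI impI)
  fix x :: "real bseq \<times> mat4 bseq" and v :: "nat \<Rightarrow> real bseq \<times> mat4 bseq"
  assume x: "x \<in> Simplex r \<times> NbarG r" and v: "\<forall>i. v i \<in> tangent_space (Simplex r \<times> NbarG r) x"
  obtain t g where tg: "x = (t, g)" "t \<in> Simplex r" "g \<in> NbarG r" using x by auto
  have s: "g i \<in> SO4" if "i \<le> r" for i using tg(3) that by (auto simp: NbarG_def)
  have det: "det (apply_bcontfun g i) \<noteq> 0" if "i \<le> r" for i using SO4_D[OF s[OF that]] by simp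
  have der: "((\<lambda>(t, g). (t, gamma r g)) has_derivative (\<lambda>u. (fst u, dgamma r g (snd u)))) (at x)"
  proof -
    have hs: "(snd has_derivative snd) (at x)"
      by (rule has_derivative_snd[OF has_derivative_ident])
    have "(gamma r \<circ> snd has_derivative dgamma r g \<circ> snd) (at x)"
      by (rule diff_chain_at[OF hs]) (use has_derivative_gamma[of r g] det tg(1) in simp)
    from has_derivative_Pair[OF has_derivative_fst[OF has_derivative_ident] this[unfolded o_def]]
    show ?thesis unfolding split_beta .
  qed
  define a where "a u w = conn_curv r t (apply_bcontfun (fst u)) (apply_bcontfun (fst w)) (\<lambda>i. lmc i g (snd u)) (\<lambda>i. lmc i g (snd w))"
    for u w :: "real bseq \<times> mat4 bseq"
  define b where "b u w = conn_curv r t (apply_bcontfun (fst u)) (apply_bcontfun (fst w)) (section_mc (gamma r g) (snd u)) (section_mc (gamma r g) (snd w))"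
    for u w :: "real bseq \<times> mat4 bseq"
  have a: "curvature r x w = a (w 0) (w 1)" for w
    using curvature_eq[of r x w] det tg(1) by (simp add: a_def)
  have b: "base_curv r (t, gamma r g) w = b (w 0) (w 1)" for w
    by (simp add: base_curv_def b_def)
  have sw: "a w u = - a u w" "b w u = - b u w" for u w
    unfolding a_def b_def by (rule conn_curv_swap)+
  have t1: "(\<Sum>i=0..r. apply_bcontfun t i) = 1" using tg(2) by (simp add: Simplex_def)
  have sv: "(\<Sum>i=0..r. apply_bcontfun (fst (v k)) i) = 0" for k using tangent_Simplex v by blast
  let ?D = "\<lambda>u. (fst u, dgamma r g (snd u))"
  have ab: "b (?D (v i)) (?D (v j)) = conj_by (g 0) (a (v i) (v j))" for i j
  proof -
    have "b (?D (v i)) (?D (v j)) = conn_curv r t (apply_bcontfun (fst (v i))) (apply_bcontfun (fst (v j)))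
       (\<lambda>k. conj_by (g 0) (lmc k g (snd (v i)) - lmc 0 g (snd (v i)))) (\<lambda>k. conj_by (g 0) (lmc k g (snd (v j)) - lmc 0 g (snd (v j))))"
      unfolding b_def fst_conv snd_conv by (rule conn_curv_cong) (simp_all add: section_mc_gamma[OF tg(3)])
    also have "\<dots> = conj_by (g 0) (a (v i) (v j))"
      unfolding conn_curv_conj_by[OF s[OF le0]] a_def
      by (simp only: conn_curv_shift[OF t1 sv sv])
    finally show ?thesis .
  qed
  show "pullback (\<lambda>(t, g). (t, gamma r g)) (Pf (base_curv r)) x v = Pf (curvature r) x v"
    unfolding pullback_def frechet_derivative_eq[OF der]
    using tg(1) Pf_eq[where A="curvature r" and x=x and a=a and v=v, OF a sw(1)]
      Pf_eq[where A="base_curv r" and x="(t, gamma r g)" and a=b and v="\<lambda>i. ?D (v i)", OF b sw(2)]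
    by (simp add: ab pf_form_conj_by[OF s[OF le0]])
qed (rule smooth_form_Pf_base_curv)

section \<open>Fibre integration over the simplex\<close>

lemma fibre_integral_Pf_integrand:
  fixes x :: "mat4 bseq" and v :: "nat \<Rightarrow> mat4 bseq" and s :: "nat \<Rightarrow> real"
  defines "W \<equiv> (\<lambda>r j. if j < r then (coord_field (Suc j), 0) else (0, v (j - r)))"
  defines "X \<equiv> (\<lambda>k. section_mc x (v k))"
  shows "Pf (base_curv 0) (bary 0 s, x) (W 0) = 0"
    "Pf (base_curv 1) (bary 1 s, x) (W 1) = (s 1 ^ 2 - s 1) * (1 / (16 * pi ^ 2) * pf_triple (X 0 1) (X 1 1) (X 2 1))"
    "Pf (base_curv 2) (bary 2 s, x) (W 2) = 1 / (16 * pi ^ 2) * (pf_form (X 1 1) (X 0 2) - pf_form (X 0 1) (X 1 2))"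
    "r \<ge> 3 \<Longrightarrow> Pf (base_curv r) (bary r s, x) (W r) = 0"
proof -
  define a where "a r u w = conn_curv r (bary r s) (apply_bcontfun (fst u)) (apply_bcontfun (fst w)) (section_mc x (snd u)) (section_mc x (snd w))"
    for r and u w :: "real bseq \<times> mat4 bseq"
  have a: "base_curv r (bary r s, x) w = a r (w 0) (w 1)" for r w by (simp add: base_curv_def a_def)
  have sw: "a r w u = - a r u w" for r u w unfolding a_def by (rule conn_curv_swap)
  note P = Pf_eq[where A="base_curv r" and x="(bary r s, x)" and a="a r" for r, OF a sw]
  \<comment> \<open>The curvature has no component with two \<open>dt\<close>.\<close>
  have hh: "a r (c, 0) (d, 0) = 0" for r c d
    by (simp add: a_def conn_curv_def section_mc_zero br.zero_right)
  \<comment> \<open>\<open>coord_field k\<close> has entry -1 at 0 and 1 at \<open>k\<close>; the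
    former is multiplied by \<open>section_mc x u 0 = 0\<close>.\<close>
  have hv: "a r (coord_field k, 0) (0, u) = section_mc x u k" if "1 \<le> k" "k \<le> r" for r k u
  proof -
    have "(\<Sum>i=0..r. coord_field k i *\<^sub>R section_mc x u i) = (\<Sum>i=0..r. if i = k then section_mc x u k else 0)"
      using that by (intro sum.cong) (auto simp: coord_field_def apply_fin_seq)
    then show ?thesis using that by (simp add: a_def conn_curv_def section_mc_zero br.zero_left)
  qed
  \<comment> \<open>Only index 1 contributes: \<open>- t_1\<close> comes from the Maurer-Cartan term
    and \<open>t_1 ^ 2\<close> from the square of the connection.\<close>
  have v1: "a 1 (0, u) (0, w) = (s 1 ^ 2 - s 1) *\<^sub>R bracket (section_mc x u 1) (section_mc x w 1)" for u w
    by (simp add: a_def conn_curv_def bary_def apply_fin_seq br.scaleR_left br.scaleR_right br.zero_left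
        br.minus_left br.minus_right power2_eq_square scaleR_diff_left)
  have v0: "a 0 (0, u) (0, w) = 0" for u w
    by (simp add: a_def conn_curv_def br.zero_left)
  show "Pf (base_curv 0) (bary 0 s, x) (W 0) = 0"
    unfolding P by (simp add: W_def v0 pf.zero_left)
  show "Pf (base_curv 1) (bary 1 s, x) (W 1) = (s 1 ^ 2 - s 1) * (1 / (16 * pi ^ 2) * pf_triple (X 0 1) (X 1 1) (X 2 1))"
  proof -
    obtain k where k: "s 1 ^ 2 - s 1 = k" by blast
    show ?thesis
      unfolding P W_def X_def k using hv[of 1 1] v1[unfolded k]
      by (simp add: pf_triple_def pf.scaleR_right right_diff_distrib distrib_left One_nat_def[symmetric]
          del: One_nat_def section_mc.simps)
  qed
  show "Pf (base_curv 2) (bary 2 s, x) (W 2) = 1 / (16 * pi ^ 2) * (pf_form (X 1 1) (X 0 2) - pf_form (X 0 1) (X 1 2))"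
    unfolding P W_def X_def using hv[of 1 2] hv[of 2 2]
    by (simp add: hh pf.zero_left pf_form_commute[of "section_mc x (v 1) 1"] One_nat_def[symmetric] del: One_nat_def section_mc.simps)
  \<comment> \<open>At least three of the four slots hold coordinate fields, so in every pairing
    some curvature factor receives two of them.\<close>
  show "Pf (base_curv r) (bary r s, x) (W r) = 0" if "r \<ge> 3"
    unfolding P W_def using that by (simp add: hh pf.zero_left pf.zero_right)
qed

lemma simplex_domain:
  "{s \<in> I \<rightarrow>\<^sub>E UNIV. (\<forall>i\<in>I. 0 \<le> s i) \<and> (\<Sum>i\<in>I. s i) \<le> (1::real)}
    = {s. (\<forall>i\<in>I. 0 \<le> s i) \<and> sum s I \<le> 1} \<inter> space (\<Pi>\<^sub>M i\<in>I. lborel)"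
  by (auto simp: space_PiM)

lemma set_integral_simplex_const:
  fixes I :: "nat set" and c :: real
  assumes "finite I"
  shows "set_lebesgue_integral (\<Pi>\<^sub>M i\<in>I. lborel)
     {s \<in> I \<rightarrow>\<^sub>E UNIV. (\<forall>i\<in>I. 0 \<le> s i) \<and> (\<Sum>i\<in>I. s i) \<le> (1::real)} (\<lambda>s. c) = c / fact (card I)"
proof -
  let ?M = "\<Pi>\<^sub>M i\<in>I. (lborel :: real measure)"
  let ?S = "{s. (\<forall>i\<in>I. 0 \<le> s i) \<and> sum s I \<le> (1::real)} \<inter> space ?M"
  have em: "emeasure ?M ?S = ennreal (1 / fact (card I))"
    using emeasure_std_simplex_aux[OF assms, of 1] by simp
  \<comment> \<open>Sets outside the sigma-algebra have \<open>emeasure\<close> 0, so the positive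
    volume also shows that the simplex is measurable.\<close>
  then have "emeasure ?M ?S \<noteq> 0" by simp
  then have S: "?S \<in> sets ?M" using emeasure_notin_sets by blast
  have "set_lebesgue_integral ?M ?S (\<lambda>s. c) = measure ?M ?S * c"
    unfolding set_lebesgue_integral_def using S em
    by (subst integral_scaleR_left) (auto simp: integrable_indicator_iff)
  also have "measure ?M ?S = 1 / fact (card I)" by (simp add: measure_def em)
  finally show ?thesis unfolding simplex_domain by simp
qed

lemma set_integral_simplex_1:
  "set_lebesgue_integral (\<Pi>\<^sub>M i\<in>{1..1::nat}. lborel)
     {s \<in> {1..1} \<rightarrow>\<^sub>E UNIV. (\<forall>i\<in>{1..1}. 0 \<le> s i) \<and> (\<Sum>i=1..1. s i) \<le> (1::real)} (\<lambda>s. (s 1 ^ 2 - s 1) * c) = - c / 6"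
proof -
  interpret product_sigma_finite "\<lambda>i::nat. lborel :: real measure" by standard
  let ?g = "\<lambda>y::real. ((y ^ 2 - y) * c) * indicat_real {0..1} y"
  have "set_lebesgue_integral (\<Pi>\<^sub>M i\<in>{1..1::nat}. lborel)
     {s \<in> {1..1} \<rightarrow>\<^sub>E UNIV. (\<forall>i\<in>{1..1}. 0 \<le> s i) \<and> (\<Sum>i=1..1. s i) \<le> (1::real)} (\<lambda>s. (s 1 ^ 2 - s 1) * c)
    = (\<integral>s. ?g (s 1) \<partial>(\<Pi>\<^sub>M i\<in>{1::nat}. lborel))"
    unfolding set_lebesgue_integral_def
    by (intro Bochner_Integration.integral_cong) (auto simp: space_PiM indicator_def)
  also have "\<dots> = integral\<^sup>L lborel ?g"
    by (rule product_integral_singleton) simp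
  also have "\<dots> = (1 ^ 3 / 3 - 1 ^ 2 / 2) * c - (0 ^ 3 / 3 - 0 ^ 2 / 2) * c"
    by (rule integral_FTC_Icc_real) (auto intro!: derivative_eq_intros continuous_intros simp: power2_eq_square)
  finally show ?thesis by simp
qed

lemma fibre_integral_Pf:
  assumes "r \<le> 4"
  shows "form_eq (NG r) (E_cochain r) (fibre_integral r (Pf (base_curv r)))"
  unfolding form_eq_def
proof (intro ballI allI impI)
  fix x :: "mat4 bseq" and v :: "nat \<Rightarrow> mat4 bseq" assume x: "x \<in> NG r"
  note I = fibre_integral_Pf_integrand[where x=x and v=v]
  consider "r = 0" | "r = 1" | "r = 2" | "r \<ge> 3" by linarith
  then show "E_cochain r x v = fibre_integral r (Pf (base_curv r)) x v"
  proof cases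
    case 1
    have "fibre_integral 0 (Pf (base_curv 0)) x v = 0"
      unfolding fibre_integral_def I(1) set_lebesgue_integral_def by simp
    then show ?thesis using 1 by (simp add: E_cochain_def)
  next
    case 4
    then show ?thesis using assms by (simp add: E_cochain_def fibre_integral_def I(4)[OF 4] set_lebesgue_integral_def)
  next
    case 2
    have g: "x 1 \<in> SO4" using NG_SO4[OF x, of 1] 2 by simp
    \<comment> \<open>Here \<open>k_1 = h_1^-1\<close>, so
      \<open>k_1^-1 dk_1 = - dh_1 h_1^-1\<close>.\<close>
    have "section_mc x u 1 = - conj_by (x 1) (lmc 1 x u)" for u
      using rmc_eq_conj_by[OF g, of u] by (simp add: rmc_def conj_by_def[of "mat 1"] SO4_D(4)[OF g[simplified]] transpose_mat)
    \<comment> \<open>The sign from three negated arguments cancels that of the integral, and 1/16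
      times 1/6 is 1/96.\<close>
    then have "fibre_integral 1 (Pf (base_curv 1)) x v = E13 x v"
      unfolding fibre_integral_def I(2) set_integral_simplex_1 E13_triple
      by (simp add: pf_triple_minus pf_triple_conj_by[OF g[simplified]])
    then show ?thesis using 2 by (simp add: E_cochain_def)
  next
    case 3
    have g: "x 1 \<in> SO4" "x 2 \<in> SO4" using NG_SO4[OF x] 3 by auto
    have s1: "section_mc x u 1 = - conj_by (x 1) (lmc 1 x u)" for u
      using rmc_eq_conj_by[OF g(1), of u]
      by (simp add: rmc_def conj_by_def[of "mat 1"] SO4_D(4)[OF g(1)[simplified]] transpose_mat)
    have s2: "section_mc x u 2 = - conj_by (x 1) (lmc 1 x u + rmc 2 x u)" for u
    proof -
      have "section_mc x u 2 = section_mc x u 1 - conj_by (x 1) (rmc 2 x u)"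
        by (simp add: numeral_2_eq_2 rmc_def SO4_D(4)[OF g(2)[unfolded numeral_2_eq_2]])
      then show ?thesis by (simp only: s1 conj_by_add minus_add_distrib diff_conv_add_uminus)
    qed
    \<comment> \<open>Conjugation by \<open>x 1\<close> drops out, the two terms pairing
      \<open>lmc 1\<close> with itself cancel by symmetry, and the area 1/2 turns 1/16 into
      1/32.\<close>
    have "fibre_integral 2 (Pf (base_curv 2)) x v = E22 x v"
      unfolding fibre_integral_def I(3) set_integral_simplex_const[OF finite_atLeastAtMost] E22_eq s1 s2
        pf.minus_left pf.minus_right pf_form_conj_by[OF g(1)] minus_minus
      using pf_form_commute[of "lmc 1 x (v 1)" "lmc 1 x (v 0)"]
      by (simp add: pf.add_left pf.add_right field_simps)
    then show ?thesis using 3 by (simp add: E_cochain_def)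
  qed
qed

lemma represents_Euler_class_E_cochain: "represents_Euler_class E_cochain"
  unfolding represents_Euler_class_def
proof (intro conjI exI allI)
  show "is_cocycle 4 E_cochain" by (rule is_cocycle_E_cochain)
  show "descended_Pf r (Pf (base_curv r))" for r by (rule descended_Pf_base_curv)
  \<comment> \<open>The two cochains agree as forms, so the zero cochain of degree 3 bounds their
    difference.\<close>
  have "d_tot 3 (\<lambda>r x v. 0) = (\<lambda>r x v. 0)"
    by (simp add: d_tot_def d_hor_zero d_ver_zero fun_eq_iff)
  then have "cochain_eq 4 (\<lambda>r x v. E_cochain r x v - fibre_integral r (Pf (base_curv r)) x v) (d_tot 3 (\<lambda>r x v. 0))"
    using fibre_integral_Pf by (simp add: cochain_eq_def form_eq_def)
  then show "cohomologous 4 E_cochain (\<lambda>r. fibre_integral r (Pf (base_curv r)))"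
    unfolding cohomologous_def is_coboundary_def
    using is_cochain_zero[of 3] by (auto intro!: exI[of _ "\<lambda>r x v. 0"])
qed

theorem theorem3p2:
  shows "smooth_form 3 (NG 1) E13
    \<and> smooth_form 2 (NG 2) E22
    \<and> form_eq (NG 1) (d_ver 1 3 E13) (\<lambda>x v. 0)
    \<and> form_eq (NG 2) (\<lambda>x v. d_hor 1 E13 x v + d_ver 2 2 E22 x v) (\<lambda>x v. 0)
    \<and> form_eq (NG 3) (d_hor 2 E22) (\<lambda>x v. 0)
    \<and> is_cocycle 4 E_cochain
    \<and> represents_Euler_class E_cochain"
  by (intro conjI smooth_form_E13 smooth_form_E22 d_ver_E13 d_hor_E13_d_ver_E22 d_hor_E22
      is_cocycle_E_cochain represents_Euler_class_E_cochain)

end
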